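(* Let $r\geqslant 3$. For any positive integer $t$, and any $r$-graph $\mathcal{T}$ with $v$ vertices and $e$ edges, there exists some constant $c$ which depends on $r$ and $t$ such that if $s\geqslant c$, then $$\mathrm{ex}_{r}(n,\mathcal{T},K_{s,t}^{(r)})=\Omega\left(n^{v-\frac{e}{t}}\right).$$
   Context: An $r$-graph is an $r$-uniform hypergraph. An $r$-graph is $\mathcal{H}$-free if it contains no copy of the $r$-graph $\mathcal{H}$ as a subhypergraph. For $r$-graphs $\mathcal{T}$ and $\mathcal{H}$, $\mathrm{ex}_{r}(n,\mathcal{T},\mathcal{H})$ is the maximum number of copies of $\mathcal{T}$ in an $n$-vertex $\mathcal{H}$-free $r$-graph. The complete bipartite $r$-graph $K_{s,t}^{(r)}$ is defined as follows: let $X_{1},X_{2},\ldots,X_{t}$ be $t$ pairwise disjoint sets of size $r-1$, and let $Y$ be a set of $s$ elements, disjoint from $\bigcup_{i=1}^{t}X_{i}$. Then $K_{s,t}^{(r)}$ has vertex set $\left(\bigcup_{i=1}^{t}X_{i}\right)\cup Y$ and edge set $\{X_{i}\cup\{y\}: 1\leqslant i\leqslant t,\ y\in Y\}$. (For $r\geqslant 3$ and $s\neq t$, $K_{s,t}^{(r)}$ and $K_{t,s}^{(r)}$ are not isomorphic.) Asymptotic notation is for $n\to\infty$ with $r,s,t,\mathcal{T}$ fixed.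
   Formalization: The constant c is allowed to depend on T as well as on r and t; with c depending only on r and t the claim fails, since for T = K_{s,t}^{(r)} with s ≥ c the extremal number is 0 while v − e/t = t(r−1) > 0. *)

theory Defs
  imports Complex_Main "HOL-Library.Landau_Symbols"
begin

text \<open>A hypergraph is a pair of a vertex set and an edge set; vertices may be isolated.\<close>

type_synonym 'a hypergraph = "'a set \<times> 'a set set"

abbreviation verts :: "'a hypergraph \<Rightarrow> 'a set" where
  "verts G \<equiv> fst G"

abbreviation edges :: "'a hypergraph \<Rightarrow> 'a set set" where
  "edges G \<equiv> snd G"

definition r_graph :: "nat \<Rightarrow> 'a hypergraph \<Rightarrow> bool" where
  "r_graph r G \<longleftrightarrow> finite (verts G) \<and> (\<forall>A \<in> edges G. A \<subseteq> verts G \<and> card A = r)"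

text \<open>The first two conjuncts ensure that \<open>S\<close> is a hypergraph on its own vertex set.
  Subhypergraphs need not be induced.\<close>

definition subhypergraph :: "'a hypergraph \<Rightarrow> 'a hypergraph \<Rightarrow> bool" where
  "subhypergraph S G \<longleftrightarrow>
     (\<forall>A \<in> edges S. A \<subseteq> verts S) \<and> verts S \<subseteq> verts G \<and> edges S \<subseteq> edges G"

definition hypergraph_iso :: "'a hypergraph \<Rightarrow> 'b hypergraph \<Rightarrow> bool" where
  "hypergraph_iso G H \<longleftrightarrow>
     (\<exists>f. bij_betw f (verts G) (verts H) \<and> (\<lambda>A. f ` A) ` edges G = edges H)"

text \<open>Copies are unlabelled: subhypergraphs are counted, not embeddings.\<close>

definition copies :: "'a hypergraph \<Rightarrow> 'b hypergraph \<Rightarrow> 'b hypergraph set" where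
  "copies T G = {S. subhypergraph S G \<and> hypergraph_iso T S}"

definition hypergraph_free :: "'a hypergraph \<Rightarrow> 'b hypergraph \<Rightarrow> bool" where
  "hypergraph_free H G \<longleftrightarrow> copies H G = {}"

text \<open>Up to isomorphism, the \<open>n\<close>-vertex \<open>r\<close>-graphs are those with vertex set \<open>{..<n}\<close>; there are
  only finitely many of these. The maximum is meaningful as soon as some such \<open>r\<close>-graph is
  \<open>H\<close>-free, in particular (by the edgeless one) whenever \<open>H\<close> has an edge.\<close>

definition ex :: "nat \<Rightarrow> nat \<Rightarrow> 'a hypergraph \<Rightarrow> 'b hypergraph \<Rightarrow> nat" where
  "ex r n T H = Max {card (copies T G) | G :: nat hypergraph.
     r_graph r G \<and> verts G = {..<n} \<and> hypergraph_free H G}"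

definition bip_X :: "nat \<Rightarrow> nat \<Rightarrow> (nat \<times> nat + nat) set" where
  "bip_X r i = {Inl (i, j) | j. j < r - 1}"

definition bip_Y :: "nat \<Rightarrow> (nat \<times> nat + nat) set" where
  "bip_Y s = {Inr k | k. k < s}"

definition complete_bip :: "nat \<Rightarrow> nat \<Rightarrow> nat \<Rightarrow> (nat \<times> nat + nat) hypergraph" where
  "complete_bip r s t =
     ((\<Union>i<t. bip_X r i) \<union> bip_Y s,
      {bip_X r i \<union> {y} | i y. i < t \<and> y \<in> bip_Y s})"

end

theory Submission
  imports Defs "HOL-Library.Function_Algebras" "HOL-Library.Z2" "HOL-Library.FuncSet"
    "HOL-Algebra.Algebraic_Closure_Type"
begin

text \<open>
  Blow up every vertex of \<open>T\<close> to a copy of \<open>\<bbbF>\<^sub>q\<^sup>t\<close>, and keep a transversal of an edge \<open>h\<close>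
  of \<open>T\<close> iff a random polynomial \<open>F\<^sub>h\<close> of bounded degree vanishes on it. A given transversal of \<open>T\<close>
  survives with probability \<open>q\<^sup>-\<^sup>e\<close>, where \<open>e\<close> is the number of edges of \<open>T\<close>;
  this gives the count. A copy of \<open>K\<^sub>s\<^sub>,\<^sub>t\<close>
  with \<open>s\<close> large yields \<open>t\<close> independent random polynomials in \<open>t\<close> variables
  with many common zeros; this has probability \<open>O(q\<^sup>-\<^sup>d\<^sup>-\<^sup>1)\<close>, so for large degree \<open>d\<close> a union bound
  over all choices of the \<open>t\<close> sets excludes it.

  The probability estimate replaces the Lang--Weil bound of the random algebraic method by a
  Hilbert-function argument on finite point sets \<open>Z\<close>. Let \<open>N(Z, m)\<close> be the number of functions on
  \<open>Z\<close> induced by polynomials of degree at most \<open>m\<close>. Every \<open>Z\<close> is a union of boundedly many sets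
  that are irreducible for products of degree at most \<open>A\<close>. If \<open>Z\<close> is irreducible with more than
  \<open>d\<close> points, a random \<open>f\<close> vanishes on \<open>Z\<close> with probability at most \<open>q\<^sup>-\<^sup>d\<^sup>-\<^sup>1\<close>; if \<open>f\<close> does
  not vanish on \<open>Z\<close>, multiplication by \<open>f\<close> is injective on functions on \<open>Z\<close>, so that
  \<open>N(Z \<inter> {f = 0}, m)\<^sup>J \<le> N(Z, m + J d)\<close>. After \<open>t\<close> steps \<open>N(Z, a) \<le> q\<^sup>a\<close>, which forces
  \<open>|Z| \<le> a\<close>.
\<close>

section \<open>Finite subfields\<close>

text \<open>The order of the field has to grow with \<open>n\<close> while a type is fixed, so
  finite fields are sets inside one ambient field.\<close>

locale finite_subfield =
  fixes K :: "'a::field set"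
  assumes finite_K: "finite K"
    and zero_K [simp]: "0 \<in> K" and one_K [simp]: "1 \<in> K"
    and diff_K: "x \<in> K \<Longrightarrow> y \<in> K \<Longrightarrow> x - y \<in> K"
    and mult_K: "x \<in> K \<Longrightarrow> y \<in> K \<Longrightarrow> x * y \<in> K"
    and inverse_K: "x \<in> K \<Longrightarrow> inverse x \<in> K"
begin

lemma uminus_K: "x \<in> K \<Longrightarrow> - x \<in> K"
  using diff_K[of 0 x] by simp

lemma add_K: "x \<in> K \<Longrightarrow> y \<in> K \<Longrightarrow> x + y \<in> K"
  using diff_K[of x "- y"] uminus_K[of y] by simp

lemma power_K: "x \<in> K \<Longrightarrow> x ^ n \<in> K"
  by (induction n) (auto intro: mult_K)

lemma prod_K: "(\<And>i. i \<in> I \<Longrightarrow> f i \<in> K) \<Longrightarrow> prod f I \<in> K"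
  by (induction I rule: infinite_finite_induct) (auto intro: mult_K)

lemma card_K_ge_2: "card K \<ge> 2"
proof -
  have "card {0, 1 :: 'a} \<le> card K"
    by (rule card_mono) (use finite_K in auto)
  thus ?thesis by simp
qed

end

section \<open>Fields of order \<open>2 ^ k\<close>\<close>

lemma alg_closure_bit_two: "(2::bit alg_closure) = 0"
proof -
  have "CHAR(bit) = 2"
  proof (rule CHAR_eq_posI)
    fix m :: nat assume "m > 0" "m < 2"
    then have "m = 1" by simp
    then show "of_nat m \<noteq> (0::bit)" by simp
  qed auto
  then have "CHAR(bit alg_closure) = 2" by simp
  then show ?thesis using of_nat_CHAR[where ?'a="bit alg_closure"] by simp
qed

text \<open>Squaring is additive in characteristic 2, and its \<open>k\<close>-fold iterate is the
  power \<open>2 ^ k\<close>.\<close>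

lemma frobenius_diff:
  fixes x y :: "bit alg_closure"
  shows "(x - y) ^ 2 ^ k = x ^ 2 ^ k - y ^ 2 ^ k"
proof (induction k)
  case (Suc k)
  have sq: "(u - v)^2 = u^2 - v^2" for u v :: "bit alg_closure"
  proof -
    have "(u - v)^2 - (u^2 - v^2) = 2 * (v^2 - u * v)"
      by (simp add: power2_eq_square algebra_simps)
    thus ?thesis using alg_closure_bit_two by simp
  qed
  have "(x - y) ^ 2 ^ Suc k = ((x - y) ^ 2 ^ k)^2"
    by (simp add: power_mult[symmetric] mult.commute)
  also have "\<dots> = (x ^ 2 ^ k)^2 - (y ^ 2 ^ k)^2" using Suc sq by simp
  also have "\<dots> = x ^ 2 ^ Suc k - y ^ 2 ^ Suc k"
    by (simp add: power_mult[symmetric] mult.commute)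
  finally show ?case .
qed simp

text \<open>\<open>K\<close> is the root set of \<open>X^q - X\<close>, closed under subtraction by
  \<open>frobenius_diff\<close>. Over the algebraic closure this polynomial splits, and its roots
  are simple because its derivative is the constant -1.\<close>

lemma finite_subfield_of_card:
  assumes "k \<ge> 1"
  obtains K :: "bit alg_closure set" where "finite_subfield K" "card K = 2 ^ k"
proof -
  define q :: nat where "q = 2 ^ k"
  have q: "q > 1" using assms one_less_power[of "2::nat" k] by (simp add: q_def)
  define p :: "bit alg_closure poly" where "p = monom 1 q - monom 1 1"
  define K where "K = {x :: bit alg_closure. x ^ q = x}"
  have deg: "degree p = q"
    using degree_add_eq_left[of "- monom 1 1 :: bit alg_closure poly" "monom 1 q"] q by (simp add: p_def degree_monom_eq)
  have p0: "p \<noteq> 0" using deg q by auto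
  have poly_p: "poly p x = x ^ q - x" for x by (simp add: p_def poly_monom)
  hence "(of_nat q :: bit alg_closure) = 0" using assms by (simp add: q_def alg_closure_bit_two power_0_left)
  hence pd: "poly (pderiv p) x = - 1" for x
    by (simp add: p_def pderiv_diff pderiv_monom poly_monom)
  obtain A where A: "size A = degree p" "p = smult (lead_coeff p) (\<Prod>x\<in>#A. [:-x, 1:])"
    using alg_closed_imp_factorization[OF p0] by blast
  have roots: "set_mset A = K"
  proof -
    have "poly p x = 0 \<longleftrightarrow> x \<in># A" for x
    proof -
      have "poly p x = lead_coeff p * (\<Prod>y\<in>#A. x - y)"
        by (subst A(2)) (simp add: poly_prod_mset)
      thus ?thesis using p0 by (auto simp: prod_mset_zero_iff)
    qed
    thus ?thesis by (auto simp: K_def poly_p)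
  qed
  have count: "count A x = 1" if "x \<in># A" for x
  proof (rule ccontr)
    assume "count A x \<noteq> 1"
    then have "{#x, x#} \<subseteq># A" using that 
      by (auto simp: subseteq_mset_def) (metis One_nat_def Suc_lessI count_greater_zero_iff less_eq_Suc_le numeral_2_eq_2)
    then obtain B where "A = add_mset x (add_mset x B)"
      by (metis subset_mset.add_diff_inverse add_mset_add_single union_mset_add_mset_left add_0)
    then have "p = [:-x, 1:] * ([:-x, 1:] * smult (lead_coeff p) (\<Prod>x\<in>#B. [:-x, 1:]))"
      by (subst A(2)) (simp add: algebra_simps)
    then obtain r where "p = [:-x, 1:] * ([:-x, 1:] * r)" by blast
    then have "poly (pderiv p) x = 0" by (simp only: pderiv_mult poly_add poly_mult) simp
    thus False by (simp add: pd)
  qed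
  have "card K = q"
    using A(1) deg count roots size_multiset_overloaded_eq[of A] by simp
  moreover have "finite_subfield K"
  proof
    show "finite K" using roots[symmetric] by simp
    show "x - y \<in> K" if "x \<in> K" "y \<in> K" for x y
      using that frobenius_diff[of x y k] by (simp add: K_def q_def)
    show "inverse x \<in> K" if "x \<in> K" for x using that by (simp add: K_def power_inverse)
  qed (use q in \<open>auto simp: K_def power_mult_distrib\<close>)
  ultimately show thesis using that by (simp add: q_def)
qed

section \<open>Polynomial functions on finite point sets\<close>

definition add_subgroup :: "'b::ab_group_add set \<Rightarrow> bool" where
  "add_subgroup A \<longleftrightarrow> 0 \<in> A \<and> (\<forall>x\<in>A. \<forall>y\<in>A. x - y \<in> A)"

lemma card_fibre:
  fixes \<phi> :: "'b::ab_group_add \<Rightarrow> 'c::ab_group_add"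
  assumes A: "add_subgroup A" and hom: "\<And>x y. x \<in> A \<Longrightarrow> y \<in> A \<Longrightarrow> \<phi> (x - y) = \<phi> x - \<phi> y"
    and b: "b \<in> A"
  shows "card {a \<in> A. \<phi> a = \<phi> b} = card {a \<in> A. \<phi> a = 0}"
proof (rule bij_betw_same_card)
  have minus: "- x \<in> A" if "x \<in> A" for x
    using A that unfolding add_subgroup_def by (metis diff_0)
  have diff: "x - y \<in> A" if "x \<in> A" "y \<in> A" for x y
    using A that by (auto simp: add_subgroup_def)
  have add: "x + y \<in> A" if "x \<in> A" "y \<in> A" for x y
    using diff[OF that(1) minus[OF that(2)]] by simp
  have hom_add: "\<phi> (x + b) = \<phi> x + \<phi> b" if "x \<in> A" for x
    using hom[OF add[OF that b] b] by simp
  show "bij_betw (\<lambda>a. a - b) {a \<in> A. \<phi> a = \<phi> b} {a \<in> A. \<phi> a = 0}"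
    by (rule bij_betwI[where g="\<lambda>a. a + b"]) (use b in \<open>auto simp: diff add hom hom_add\<close>)
qed

text \<open>All fibres are translates of the kernel. In probabilistic terms, an additive map sends
  the uniform distribution on \<open>A\<close> to the uniform distribution on its image.\<close>

lemma card_preimage:
  fixes \<phi> :: "'b::ab_group_add \<Rightarrow> 'c::ab_group_add"
  assumes "add_subgroup A" "\<And>x y. x \<in> A \<Longrightarrow> y \<in> A \<Longrightarrow> \<phi> (x - y) = \<phi> x - \<phi> y"
    and "finite A" "B \<subseteq> \<phi> ` A"
  shows "card {a \<in> A. \<phi> a \<in> B} = card B * card {a \<in> A. \<phi> a = 0}"
proof -
  have fB: "finite B" using assms by (meson finite_imageI finite_subset)
  have "{a \<in> A. \<phi> a \<in> B} = (\<Union>b\<in>B. {a \<in> A. \<phi> a = b})" by auto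
  also have "card \<dots> = (\<Sum>b\<in>B. card {a \<in> A. \<phi> a = b})"
    by (rule card_UN_disjoint) (use fB \<open>finite A\<close> in auto)
  also have "\<dots> = (\<Sum>b\<in>B. card {a \<in> A. \<phi> a = 0})"
  proof (rule sum.cong)
    fix b assume "b \<in> B"
    with assms(4) obtain a where "a \<in> A" "b = \<phi> a" by auto
    then show "card {a \<in> A. \<phi> a = b} = card {a \<in> A. \<phi> a = 0}"
      using card_fibre[of A \<phi> a] assms by simp
  qed simp
  finally show ?thesis by simp
qed

lemma card_eq_image_kernel:
  fixes \<phi> :: "'b::ab_group_add \<Rightarrow> 'c::ab_group_add"
  assumes "add_subgroup A" "\<And>x y. x \<in> A \<Longrightarrow> y \<in> A \<Longrightarrow> \<phi> (x - y) = \<phi> x - \<phi> y"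
    and "finite A"
  shows "card A = card (\<phi> ` A) * card {a \<in> A. \<phi> a = 0}"
proof -
  have "{a \<in> A. \<phi> a \<in> \<phi> ` A} = A" by auto
  with card_preimage[OF assms subset_refl] show ?thesis by simp
qed

text \<open>Extension by zero, unlike \<^const>\<open>PiE\<close>, gives additive subgroups, so that fibres can be counted.\<close>

definition supp_funs :: "'i set \<Rightarrow> ('i \<Rightarrow> 'b set) \<Rightarrow> ('i \<Rightarrow> 'b::zero) set" where
  "supp_funs I B = {x. (\<forall>i\<in>I. x i \<in> B i) \<and> (\<forall>i. i \<notin> I \<longrightarrow> x i = 0)}"

lemma supp_funs_bij: "bij_betw (\<lambda>x. restrict x I) (supp_funs I B) (PiE I B)"
  by (rule bij_betwI[where g="\<lambda>x i. if i \<in> I then x i else 0"])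
     (auto simp: supp_funs_def PiE_def extensional_def fun_eq_iff)

lemma card_supp_funs: "finite I \<Longrightarrow> card (supp_funs I B) = (\<Prod>i\<in>I. card (B i))"
  using bij_betw_same_card[OF supp_funs_bij, of I B] by (simp add: card_PiE)

lemma finite_supp_funs: "finite I \<Longrightarrow> (\<And>i. i \<in> I \<Longrightarrow> finite (B i)) \<Longrightarrow> finite (supp_funs I B)"
  using bij_betw_finite[OF supp_funs_bij, of I B] by (simp add: finite_PiE)

lemma add_subgroup_supp_funs:
  assumes "\<And>i. i \<in> I \<Longrightarrow> add_subgroup (B i)"
  shows "add_subgroup (supp_funs I B)"
  using assms by (auto simp: add_subgroup_def supp_funs_def)

definition zrestrict :: "'x set \<Rightarrow> ('x \<Rightarrow> 'b) \<Rightarrow> 'x \<Rightarrow> 'b::zero" where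
  "zrestrict Z f = (\<lambda>x. if x \<in> Z then f x else 0)"

lemma zrestrict_diff: "zrestrict Z (f - g) = zrestrict Z f - zrestrict Z (g :: 'x \<Rightarrow> 'b::ab_group_add)"
  by (auto simp: zrestrict_def)

lemma zrestrict_eq_iff: "zrestrict Z f = zrestrict Z g \<longleftrightarrow> (\<forall>x\<in>Z. f x = g x)"
  unfolding zrestrict_def fun_eq_iff by metis

lemma zrestrict_zrestrict: "Z \<subseteq> W \<Longrightarrow> zrestrict Z (zrestrict W f) = zrestrict Z f"
  by (auto simp: zrestrict_def fun_eq_iff)

section \<open>Polynomials of bounded degree in each variable\<close>

context finite_subfield
begin

text \<open>The bound \<open>m\<close> is on the degree in each variable separately.\<close>

inductive_set polys :: "'i set \<Rightarrow> nat \<Rightarrow> (('i \<Rightarrow> 'a) \<Rightarrow> 'a) set" for I m where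
  mono: "c \<in> K \<Longrightarrow> (\<And>i. i \<in> I \<Longrightarrow> \<alpha> i \<le> m) \<Longrightarrow> (\<lambda>x. c * (\<Prod>i\<in>I. x i ^ \<alpha> i)) \<in> polys I m"
| add: "f \<in> polys I m \<Longrightarrow> g \<in> polys I m \<Longrightarrow> f + g \<in> polys I m"

abbreviation pts :: "'i set \<Rightarrow> ('i \<Rightarrow> 'a) set" where
  "pts I \<equiv> supp_funs I (\<lambda>_. K)"

lemma polys_mono:
  assumes "f \<in> polys I a" "I \<subseteq> J" "finite J" "a \<le> b"
  shows "f \<in> polys J b"
  using assms(1)
proof induction
  case (mono c \<alpha>)
  define \<beta> where "\<beta> = (\<lambda>i. if i \<in> I then \<alpha> i else 0)"
  have "(\<Prod>i\<in>I. x i ^ \<alpha> i) = (\<Prod>i\<in>J. x i ^ \<beta> i)" for x :: "_ \<Rightarrow> 'a"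
    by (rule prod.mono_neutral_cong_left) (use assms in \<open>auto simp: \<beta>_def\<close>)
  moreover have "(\<lambda>x. c * (\<Prod>i\<in>J. x i ^ \<beta> i)) \<in> polys J b"
    by (rule polys.mono) (use mono assms in \<open>auto simp: \<beta>_def intro: le_trans\<close>)
  ultimately show ?case by simp
qed (rule polys.add)

lemma polys_const: "c \<in> K \<Longrightarrow> (\<lambda>_. c) \<in> polys I m"
  using polys.mono[of c I "\<lambda>_. 0" m] by simp

lemma polys_scale:
  assumes "f \<in> polys I m" "c \<in> K"
  shows "(\<lambda>x. c * f x) \<in> polys I m"
  using assms(1)
proof induction
  case (mono d \<alpha>)
  have "(\<lambda>x. (c * d) * (\<Prod>i\<in>I. x i ^ \<alpha> i)) \<in> polys I m"
    by (rule polys.mono) (use mono assms in \<open>auto intro: mult_K\<close>)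
  then show ?case by (simp add: mult.assoc)
next
  case (add f g)
  from polys.add[OF add.IH] show ?case by (simp add: plus_fun_def distrib_left)
qed

lemma polys_diff:
  assumes "f \<in> polys I m" "g \<in> polys I m"
  shows "f - g \<in> polys I m"
proof -
  have "f + (\<lambda>x. (- 1) * g x) \<in> polys I m"
    by (intro polys.add polys_scale assms uminus_K one_K)
  then show ?thesis by (simp add: plus_fun_def fun_diff_def)
qed

lemma polys_sum:
  assumes "\<And>s. s \<in> S \<Longrightarrow> f s \<in> polys I m"
  shows "(\<lambda>x. \<Sum>s\<in>S. f s x) \<in> polys I m"
  using assms
proof (induction S rule: infinite_finite_induct)
  case (insert s S)
  have "f s + (\<lambda>x. \<Sum>s\<in>S. f s x) \<in> polys I m"
    by (rule polys.add) (use insert in auto)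
  with insert show ?case by (simp add: plus_fun_def)
qed (simp_all add: polys_const)

lemma polys_mult:
  assumes "f \<in> polys I a" "g \<in> polys I b"
  shows "f * g \<in> polys I (a + b)"
  using assms(1)
proof induction
  case (mono c \<alpha>)
  from assms(2) show ?case
  proof induction
    case (mono d \<beta>)
    have "(\<lambda>x. (c * d) * (\<Prod>i\<in>I. x i ^ (\<alpha> i + \<beta> i))) \<in> polys I (a + b)"
      by (rule polys.mono)
         (use mono \<open>c \<in> K\<close> \<open>\<And>i. i \<in> I \<Longrightarrow> \<alpha> i \<le> a\<close> in \<open>auto intro: mult_K add_mono\<close>)
    then show ?case by (simp add: times_fun_def power_add prod.distrib mult_ac)
  next
    case (add f g)
    from polys.add[OF add.IH] show ?case by (simp only: distrib_left)
  qed
next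
  case (add f h)
  from polys.add[OF add.IH] show ?case by (simp only: distrib_right)
qed

text \<open>As the degree is bounded in each variable separately, a product in disjoint sets of
  variables keeps the bound \<open>m\<close> instead of doubling it.\<close>

lemma polys_mult_disjoint:
  assumes "f \<in> polys I m" "g \<in> polys J m" "I \<inter> J = {}" "finite I" "finite J"
  shows "f * g \<in> polys (I \<union> J) m"
  using assms(1)
proof induction
  case (mono c \<alpha>)
  from assms(2) show ?case
  proof induction
    case (mono d \<beta>)
    define \<gamma> where "\<gamma> = (\<lambda>i. if i \<in> I then \<alpha> i else \<beta> i)"
    have eq: "(\<Prod>i\<in>I \<union> J. x i ^ \<gamma> i) = (\<Prod>i\<in>I. x i ^ \<alpha> i) * (\<Prod>i\<in>J. x i ^ \<beta> i)"
      for x :: "_ \<Rightarrow> 'a"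
    proof -
      have "(\<Prod>i\<in>J. x i ^ \<gamma> i) = (\<Prod>i\<in>J. x i ^ \<beta> i)"
        by (rule prod.cong) (use assms(3) in \<open>auto simp: \<gamma>_def\<close>)
      moreover have "(\<Prod>i\<in>I. x i ^ \<gamma> i) = (\<Prod>i\<in>I. x i ^ \<alpha> i)"
        by (rule prod.cong) (auto simp: \<gamma>_def)
      ultimately show ?thesis using assms by (simp add: prod.union_disjoint)
    qed
    have "(\<lambda>x. (c * d) * (\<Prod>i\<in>I \<union> J. x i ^ \<gamma> i)) \<in> polys (I \<union> J) m"
      by (rule polys.mono)
         (use mono \<open>c \<in> K\<close> \<open>\<And>i. i \<in> I \<Longrightarrow> \<alpha> i \<le> m\<close> in \<open>auto simp: \<gamma>_def intro: mult_K\<close>)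
    then show ?case by (simp add: times_fun_def eq mult_ac)
  next
    case (add f g)
    from polys.add[OF add.IH] show ?case by (simp only: distrib_left)
  qed
next
  case (add f h)
  from polys.add[OF add.IH] show ?case by (simp only: distrib_right)
qed

lemma polys_var:
  assumes "i \<in> I" "finite I"
  shows "(\<lambda>x. x i) \<in> polys I 1"
proof -
  have "(\<lambda>x. 1 * (\<Prod>j\<in>{i}. x j ^ 1)) \<in> polys {i} 1" by (rule polys.mono) auto
  then show ?thesis using assms by (auto intro: polys_mono)
qed

lemma polys_in_K: "f \<in> polys I m \<Longrightarrow> (\<And>i. i \<in> I \<Longrightarrow> x i \<in> K) \<Longrightarrow> f x \<in> K"
  by (induction rule: polys.induct) (auto intro!: mult_K prod_K power_K add_K)

lemma polys_cong: "f \<in> polys I m \<Longrightarrow> (\<And>i. i \<in> I \<Longrightarrow> x i = y i) \<Longrightarrow> f x = f y"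
  by (induction rule: polys.induct) (auto intro: prod.cong)

text \<open>Variables are pairs of a vertex and a coordinate. With every row but that of
  \<open>a\<close> frozen, a monomial becomes one in row \<open>a\<close>, and its coefficient
  absorbs the other factors.\<close>

lemma polys_slice:
  assumes f: "f \<in> polys (e \<times> N) m" and fin: "finite e" "finite N" and a: "a \<in> e"
    and z: "\<And>i. i \<in> e \<times> N \<Longrightarrow> z i \<in> K"
  shows "(\<lambda>y. f (\<lambda>(u, k). if u = a then y k else z (u, k))) \<in> polys N m"
  using f
proof induction
  case (mono c \<alpha>)
  let ?z = "\<Prod>i\<in>(e - {a}) \<times> N. z i ^ \<alpha> i"
  have split: "(\<Prod>i\<in>e \<times> N. (case i of (u, k) \<Rightarrow> if u = a then y k else z (u, k)) ^ \<alpha> i)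
      = ?z * (\<Prod>k\<in>N. y k ^ \<alpha> (a, k))" (is "prod ?F _ = _") for y :: "_ \<Rightarrow> 'a"
  proof -
    have "e \<times> N = (e - {a}) \<times> N \<union> {a} \<times> N" using a by auto
    then have "prod ?F (e \<times> N) = prod ?F ((e - {a}) \<times> N) * prod ?F ({a} \<times> N)"
      using fin prod.union_disjoint[of "(e - {a}) \<times> N" "{a} \<times> N" ?F] by fastforce
    moreover have "prod ?F ((e - {a}) \<times> N) = ?z"
      by (rule prod.cong) (auto split: if_split_asm)
    moreover have "prod ?F ({a} \<times> N) = (\<Prod>k\<in>N. y k ^ \<alpha> (a, k))"
      by (rule prod.reindex_bij_witness[where i="\<lambda>k. (a, k)" and j=snd]) auto
    ultimately show ?thesis by simp
  qed
  have "(\<lambda>y. (c * ?z) * (\<Prod>k\<in>N. y k ^ \<alpha> (a, k))) \<in> polys N m"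
    by (rule polys.mono) (use mono a z in \<open>auto intro!: mult_K prod_K power_K\<close>)
  then show ?case unfolding split by (simp add: mult.assoc)
next
  case (add f g)
  from polys.add[OF add.IH] show ?case by (simp add: plus_fun_def)
qed

lemma polys_row:
  assumes "g \<in> polys N m"
  shows "(\<lambda>x. g (\<lambda>k. x (a, k))) \<in> polys ({a} \<times> N) m"
  using assms
proof induction
  case (mono c \<alpha>)
  have "(\<lambda>x. c * (\<Prod>i\<in>{a} \<times> N. x i ^ \<alpha> (snd i))) \<in> polys ({a} \<times> N) m"
    by (rule polys.mono) (use mono in auto)
  moreover have "(\<Prod>i\<in>{a} \<times> N. x i ^ \<alpha> (snd i)) = (\<Prod>k\<in>N. x (a, k) ^ \<alpha> k)" for x :: "_ \<Rightarrow> 'a"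
    by (rule prod.reindex_bij_witness[where i="\<lambda>k. (a, k)" and j=snd]) auto
  ultimately show ?case by simp
next
  case (add f g)
  from polys.add[OF add.IH] show ?case by (simp add: plus_fun_def)
qed

text \<open>Every member is the evaluation \<open>\<Phi> c\<close> of a coefficient vector
  \<open>c\<close>, indexed by the \<open>(m + 1) ^ card I\<close> exponent vectors in
  \<open>E\<close>.\<close>

lemma
  fixes I :: "'i set"
  assumes "finite I"
  shows finite_polys: "finite (polys I m)"
    and card_polys: "card (polys I m) \<le> card K ^ ((m + 1) ^ card I)"
proof -
  define E :: "('i \<Rightarrow> nat) set" where "E = supp_funs I (\<lambda>_. {..m})"
  have E: "finite E" "card E = (m + 1) ^ card I"
    using assms by (simp_all add: E_def finite_supp_funs card_supp_funs)
  define \<Phi> where "\<Phi> = (\<lambda>c (x :: 'i \<Rightarrow> 'a). \<Sum>\<alpha>\<in>E. c \<alpha> * (\<Prod>i\<in>I. x i ^ \<alpha> i))"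
  have sub: "polys I m \<subseteq> \<Phi> ` supp_funs E (\<lambda>_. K)"
  proof
    fix f assume "f \<in> polys I m"
    then show "f \<in> \<Phi> ` supp_funs E (\<lambda>_. K)"
    proof induction
      case (mono c \<alpha>)
      define \<beta> where "\<beta> = (\<lambda>i. if i \<in> I then \<alpha> i else 0)"
      define d where "d = (\<lambda>\<gamma>. if \<gamma> = \<beta> then c else 0)"
      have "\<beta> \<in> E" using mono by (auto simp: \<beta>_def E_def supp_funs_def)
      have "(\<lambda>x. c * (\<Prod>i\<in>I. x i ^ \<alpha> i)) = \<Phi> d"
      proof
        fix x :: "'i \<Rightarrow> 'a"
        have "\<Phi> d x = (\<Sum>\<gamma>\<in>E. if \<gamma> = \<beta> then c * (\<Prod>i\<in>I. x i ^ \<beta> i) else 0)"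
          unfolding \<Phi>_def by (rule sum.cong) (auto simp: d_def)
        also have "\<dots> = c * (\<Prod>i\<in>I. x i ^ \<beta> i)" using E \<open>\<beta> \<in> E\<close> by simp
        also have "(\<Prod>i\<in>I. x i ^ \<beta> i) = (\<Prod>i\<in>I. x i ^ \<alpha> i)"
          by (rule prod.cong) (auto simp: \<beta>_def)
        finally show "c * (\<Prod>i\<in>I. x i ^ \<alpha> i) = \<Phi> d x" ..
      qed
      moreover have "d \<in> supp_funs E (\<lambda>_. K)"
        using \<open>\<beta> \<in> E\<close> mono by (auto simp: d_def supp_funs_def)
      ultimately show ?case by blast
    next
      case (add f g)
      then obtain c d where cd: "f = \<Phi> c" "g = \<Phi> d" "c \<in> supp_funs E (\<lambda>_. K)" "d \<in> supp_funs E (\<lambda>_. K)"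
        by blast
      have "f + g = \<Phi> (c + d)"
        unfolding cd by (simp add: \<Phi>_def fun_eq_iff distrib_right sum.distrib)
      moreover have "c + d \<in> supp_funs E (\<lambda>_. K)"
        using cd by (auto simp: supp_funs_def add_K)
      ultimately show ?case by blast
    qed
  qed
  have fin: "finite (supp_funs E (\<lambda>_. K))" using E finite_K by (simp add: finite_supp_funs)
  then show "finite (polys I m)" using sub by (meson finite_imageI finite_subset)
  have "card (polys I m) \<le> card (\<Phi> ` supp_funs E (\<lambda>_. K))"
    by (rule card_mono) (use fin sub in auto)
  also have "\<dots> \<le> card (supp_funs E (\<lambda>_. K))" by (rule card_image_le[OF fin])
  also have "\<dots> = card K ^ ((m + 1) ^ card I)" using E by (simp add: card_supp_funs)
  finally show "card (polys I m) \<le> card K ^ ((m + 1) ^ card I)" .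
qed

text \<open>Multiply one affine factor for each \<open>y \<in> S\<close>, in a coordinate where
  \<open>y\<close> and \<open>p\<close> differ, scaled to be 1 at \<open>p\<close>.\<close>

lemma polys_separate:
  assumes "finite S" "S \<subseteq> pts I" "p \<in> pts I" "p \<notin> S" "finite I"
  shows "\<exists>f\<in>polys I (card S). f p = 1 \<and> (\<forall>x\<in>S. f x = 0)"
  using assms(1,2,4)
proof (induction S)
  case empty
  show ?case using polys_const[OF one_K, of I 0] by (intro bexI[of _ "\<lambda>_. 1"]) auto
next
  case (insert y S)
  then obtain f where f: "f \<in> polys I (card S)" "f p = 1" "\<forall>x\<in>S. f x = 0" by auto
  have "y \<noteq> p" using insert by auto
  then obtain i where i: "y i \<noteq> p i" by auto
  have y: "y \<in> pts I" using insert by auto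
  then have "i \<in> I" using i assms(3) by (cases "i \<in> I") (auto simp: supp_funs_def)
  define h where "h = (\<lambda>x :: 'b \<Rightarrow> 'a. inverse (p i - y i) * ((\<lambda>x. x i) - (\<lambda>_. y i)) x)"
  have "h \<in> polys I 1"
    unfolding h_def using i \<open>i \<in> I\<close> y assms(3,5)
    by (intro polys_scale polys_diff polys_var polys_const inverse_K diff_K) (auto simp: supp_funs_def)
  then have "f * h \<in> polys I (card (insert y S))"
    using polys_mult[OF f(1), of h 1] insert by simp
  moreover have "(f * h) p = 1" using f i by (simp add: h_def)
  moreover have "\<forall>x\<in>insert y S. (f * h) x = 0" using f by (auto simp: h_def)
  ultimately show ?case by blast
qed

text \<open>Lagrange interpolation: each basis polynomial has to vanish at only
  \<open>card S - 1 \<le> m\<close> points.\<close>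

lemma polys_interpolate:
  assumes "finite S" "S \<subseteq> pts I" "finite I" "card S \<le> m + 1" "\<And>x. x \<in> S \<Longrightarrow> g x \<in> K"
  shows "\<exists>f\<in>polys I m. \<forall>x\<in>S. f x = g x"
proof -
  have "\<forall>p\<in>S. \<exists>f\<in>polys I m. f p = 1 \<and> (\<forall>x\<in>S - {p}. f x = 0)"
  proof
    fix p assume p: "p \<in> S"
    have "\<exists>f\<in>polys I (card (S - {p})). f p = 1 \<and> (\<forall>x\<in>S - {p}. f x = 0)"
      by (rule polys_separate) (use assms p in auto)
    then obtain f where f: "f \<in> polys I (card (S - {p}))" "f p = 1" "\<forall>x\<in>S - {p}. f x = 0"
      by blast
    have "card (S - {p}) \<le> m" using assms p by simp
    then show "\<exists>f\<in>polys I m. f p = 1 \<and> (\<forall>x\<in>S - {p}. f x = 0)"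
      using f polys_mono[OF f(1) subset_refl \<open>finite I\<close>] by blast
  qed
  then obtain F where F: "\<And>p. p \<in> S \<Longrightarrow> F p \<in> polys I m" "\<And>p. p \<in> S \<Longrightarrow> F p p = 1"
    "\<And>p x. p \<in> S \<Longrightarrow> x \<in> S \<Longrightarrow> x \<noteq> p \<Longrightarrow> F p x = 0"
    by (metis Diff_iff empty_iff insert_iff)
  define f where "f = (\<lambda>x. \<Sum>p\<in>S. g p * F p x)"
  have "f \<in> polys I m" unfolding f_def by (intro polys_sum polys_scale F assms)
  moreover have "f x = g x" if x: "x \<in> S" for x
  proof -
    have "f x = (\<Sum>p\<in>S. if p = x then g x else 0)"
      unfolding f_def by (rule sum.cong) (use F x in auto)
    then show ?thesis using x assms(1) by simp
  qed
  ultimately show ?thesis by blast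
qed

text \<open>Its cardinality is the \<open>N(Z, m)\<close> of the introduction, a Hilbert function in
  multiplicative form: \<open>card K\<close> to the power of the dimension.\<close>

definition poly_funs :: "'i set \<Rightarrow> nat \<Rightarrow> ('i \<Rightarrow> 'a) set \<Rightarrow> (('i \<Rightarrow> 'a) \<Rightarrow> 'a) set" where
  "poly_funs I m Z = zrestrict Z ` polys I m"

lemma finite_poly_funs: "finite I \<Longrightarrow> finite (poly_funs I m Z)"
  by (simp add: poly_funs_def finite_polys)

lemma card_poly_funs_le: "finite I \<Longrightarrow> card (poly_funs I m Z) \<le> card K ^ ((m + 1) ^ card I)"
  using card_image_le[OF finite_polys] card_polys unfolding poly_funs_def by (rule le_trans)

lemma add_subgroup_poly_funs: "add_subgroup (poly_funs I m Z)"
  unfolding add_subgroup_def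
proof (intro conjI ballI)
  have "zrestrict Z (\<lambda>_. 0) \<in> poly_funs I m Z"
    unfolding poly_funs_def by (intro imageI polys_const zero_K)
  then show "0 \<in> poly_funs I m Z" by (simp add: zrestrict_def zero_fun_def)
  fix f g assume "f \<in> poly_funs I m Z" "g \<in> poly_funs I m Z"
  then obtain f' g' where "f = zrestrict Z f'" "g = zrestrict Z g'" "f' \<in> polys I m" "g' \<in> polys I m"
    by (auto simp: poly_funs_def)
  then show "f - g \<in> poly_funs I m Z"
    unfolding poly_funs_def using polys_diff[of f' I m g'] by (auto simp: zrestrict_diff[symmetric])
qed

lemma poly_funs_restrict: "Z \<subseteq> W \<Longrightarrow> zrestrict Z ` poly_funs I m W = poly_funs I m Z"
  by (simp add: poly_funs_def image_image zrestrict_zrestrict)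

lemma card_poly_funs_mono:
  assumes "finite I" "Z \<subseteq> W" "m \<le> n"
  shows "card (poly_funs I m Z) \<le> card (poly_funs I n W)"
proof -
  have "card (poly_funs I m Z) \<le> card (poly_funs I n Z)"
    by (rule card_mono) (use assms finite_poly_funs in \<open>auto simp: poly_funs_def intro: polys_mono\<close>)
  also have "\<dots> \<le> card (poly_funs I n W)"
    using card_image_le[OF finite_poly_funs[OF assms(1)]] poly_funs_restrict[OF assms(2)] by metis
  finally show ?thesis .
qed

text \<open>Interpolation at \<open>m + 1\<close> points of \<open>Z\<close> realises all
  \<open>K\<close>-valued functions on them.\<close>

lemma card_poly_funs_ge:
  assumes "finite I" "Z \<subseteq> pts I" "m < card Z"
  shows "card K ^ (m + 1) \<le> card (poly_funs I m Z)"
proof -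
  obtain S where S: "S \<subseteq> Z" "card S = m + 1" "finite S"
    using assms(3) obtain_subset_with_card_n[of "m + 1" Z] by auto
  have "supp_funs S (\<lambda>_. K) \<subseteq> poly_funs I m S"
  proof
    fix g assume g: "g \<in> supp_funs S (\<lambda>_. K)"
    have "\<exists>f\<in>polys I m. \<forall>x\<in>S. f x = g x"
      by (rule polys_interpolate) (use S assms g in \<open>auto simp: supp_funs_def\<close>)
    then obtain f where f: "f \<in> polys I m" "\<forall>x\<in>S. f x = g x" by blast
    then have "g = zrestrict S f" using g by (auto simp: supp_funs_def zrestrict_def)
    then show "g \<in> poly_funs I m S" using f by (simp add: poly_funs_def)
  qed
  then have "card (supp_funs S (\<lambda>_. K)) \<le> card (poly_funs I m S)"
    by (rule card_mono[OF finite_poly_funs[OF assms(1)]])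
  also have "\<dots> \<le> card (poly_funs I m Z)" by (rule card_poly_funs_mono) (use S assms in auto)
  finally show ?thesis using S by (simp add: card_supp_funs)
qed

end

section \<open>Common zeros of random polynomials\<close>

context finite_subfield
begin

text \<open>The vanishing ideal of \<open>Z\<close> is prime as far as products of degree at most
  \<open>A\<close> can tell. The truncation keeps the number of parts in a decomposition bounded
  independently of \<open>card K\<close>.\<close>

definition irreducible_upto :: "'i set \<Rightarrow> nat \<Rightarrow> ('i \<Rightarrow> 'a) set \<Rightarrow> bool" where
  "irreducible_upto I A Z \<longleftrightarrow> (\<forall>a b. a + b \<le> A \<longrightarrow> (\<forall>f\<in>polys I a. \<forall>g\<in>polys I b.
     (\<forall>x\<in>Z. f x * g x = 0) \<longrightarrow> (\<forall>x\<in>Z. f x = 0) \<or> (\<forall>x\<in>Z. g x = 0)))"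

section \<open>Hilbert functions of hypersurface sections\<close>

lemma poly_funs_nonempty: "poly_funs I m Z \<noteq> {}"
  using add_subgroup_poly_funs[of I m Z] by (auto simp: add_subgroup_def)

lemma card_poly_funs_pos: "finite I \<Longrightarrow> card (poly_funs I m Z) \<ge> 1"
  using poly_funs_nonempty[of I m Z] finite_poly_funs[of I m Z] by (simp add: Suc_le_eq card_gt_0_iff)

text \<open>Restriction from \<open>Z\<close> to \<open>Y\<close> is onto, and \<open>\<psi>\<close>
  embeds \<open>S\<close> into its kernel.\<close>

lemma card_poly_funs_kernel:
  assumes "finite I" "Y \<subseteq> Z"
    and "inj_on \<psi> S" "\<And>s. s \<in> S \<Longrightarrow> \<psi> s \<in> poly_funs I m Z" "\<And>s x. s \<in> S \<Longrightarrow> x \<in> Y \<Longrightarrow> \<psi> s x = 0"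
  shows "card (poly_funs I m Y) * card S \<le> card (poly_funs I m Z)"
proof -
  let ?ker = "{h \<in> poly_funs I m Z. zrestrict Y h = 0}"
  have "card S \<le> card ?ker"
    by (rule card_inj_on_le[OF assms(3)])
       (use assms finite_poly_funs[OF assms(1), of m Z] in \<open>auto simp: zrestrict_def fun_eq_iff\<close>)
  moreover have "card (poly_funs I m Z) = card (zrestrict Y ` poly_funs I m Z) * card ?ker"
    by (rule card_eq_image_kernel) (auto simp: add_subgroup_poly_funs zrestrict_diff finite_poly_funs assms)
  ultimately show ?thesis
    unfolding poly_funs_restrict[OF assms(2)] by (simp add: mult_le_mono2)
qed

text \<open>The kernel of restriction contains the \<open>card K\<close> scalar multiples of
  \<open>f\<close>, which are distinct because \<open>f\<close> is nonzero somewhere on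
  \<open>Z\<close>.\<close>

lemma card_poly_funs_zero_set:
  assumes "finite I" "f \<in> polys I m" "\<exists>z\<in>Z. f z \<noteq> 0"
  shows "card (poly_funs I m {x \<in> Z. f x = 0}) * card K \<le> card (poly_funs I m Z)"
proof (rule card_poly_funs_kernel[where \<psi>="\<lambda>c. zrestrict Z (\<lambda>x. c * f x)"])
  show "inj_on (\<lambda>c. zrestrict Z (\<lambda>x. c * f x)) K"
    by (rule inj_onI) (use assms(3) in \<open>auto simp: zrestrict_eq_iff\<close>)
  show "zrestrict Z (\<lambda>x. c * f x) \<in> poly_funs I m Z" if "c \<in> K" for c
    unfolding poly_funs_def by (intro imageI polys_scale assms that)
qed (use assms in \<open>auto simp: zrestrict_def\<close>)

text \<open>By irreducibility \<open>g * f = h * f\<close> on \<open>Z\<close> forces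
  \<open>g = h\<close> there, so the multiples of \<open>f\<close> put a copy of
  \<open>poly_funs I m Z\<close> into the kernel.\<close>

lemma card_poly_funs_irreducible:
  assumes "finite I" "irreducible_upto I A Z" "f \<in> polys I d" "\<exists>z\<in>Z. f z \<noteq> 0" "m + d \<le> A"
  shows "card (poly_funs I (m + d) {x \<in> Z. f x = 0}) * card (poly_funs I m Z) \<le> card (poly_funs I (m + d) Z)"
proof (rule card_poly_funs_kernel[where \<psi>="\<lambda>g. zrestrict Z (g * f)"])
  have *: "zrestrict Z (zrestrict Z g * f) = zrestrict Z (g * f)" for g
    by (auto simp: zrestrict_def)
  show "inj_on (\<lambda>g. zrestrict Z (g * f)) (poly_funs I m Z)"
  proof (rule inj_onI)
    fix g h assume "g \<in> poly_funs I m Z" "h \<in> poly_funs I m Z"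
      and eq: "zrestrict Z (g * f) = zrestrict Z (h * f)"
    then obtain g' h' where gh: "g = zrestrict Z g'" "h = zrestrict Z h'"
      "g' \<in> polys I m" "h' \<in> polys I m"
      by (auto simp: poly_funs_def)
    have "\<forall>x\<in>Z. (g' - h') x * f x = 0"
      using eq unfolding gh * by (auto simp: zrestrict_eq_iff left_diff_distrib)
    then have "\<forall>x\<in>Z. (g' - h') x = 0"
      using assms polys_diff[OF gh(3,4)] unfolding irreducible_upto_def by blast
    then show "g = h" by (simp add: gh zrestrict_eq_iff)
  qed
  show "zrestrict Z (g * f) \<in> poly_funs I (m + d) Z" if "g \<in> poly_funs I m Z" for g
    using that assms(3) by (auto simp: poly_funs_def * intro: polys_mult)
qed (use assms in \<open>auto simp: zrestrict_def\<close>)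

text \<open>Each of \<open>J\<close> rounds raises the degree by \<open>d\<close> and gains a factor
  for the zero set of \<open>f\<close>; by monotonicity in the degree this factor is at least its
  value in degree \<open>m\<close>.\<close>

lemma card_poly_funs_power:
  assumes "finite I" "irreducible_upto I A Z" "f \<in> polys I d" "\<exists>z\<in>Z. f z \<noteq> 0" "m + J * d \<le> A"
  shows "card (poly_funs I m {x \<in> Z. f x = 0}) ^ J \<le> card (poly_funs I (m + J * d) Z)"
  using assms(5)
proof (induction J)
  case 0
  show ?case using card_poly_funs_pos[OF assms(1)] by simp
next
  case (Suc J)
  let ?Y = "{x \<in> Z. f x = 0}"
  have "card (poly_funs I m ?Y) ^ Suc J \<le> card (poly_funs I m ?Y) * card (poly_funs I (m + J * d) Z)"
    using Suc by simp
  also have "\<dots> \<le> card (poly_funs I (m + J * d + d) ?Y) * card (poly_funs I (m + J * d) Z)"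
    by (rule mult_le_mono1, rule card_poly_funs_mono[OF assms(1)]) auto
  also have "\<dots> \<le> card (poly_funs I (m + J * d + d) Z)"
    by (rule card_poly_funs_irreducible[OF assms(1-4)]) (use Suc in simp)
  finally show ?case by (simp add: add_ac)
qed

text \<open>A reducible \<open>Z\<close> is the union of two proper zero sets, and each has its
  function count reduced by a factor \<open>card K\<close>. The splitting tree therefore has depth
  at most \<open>n\<close>.\<close>

lemma irreducible_decomposition:
  assumes "finite I" "card (poly_funs I A Z) \<le> card K ^ n"
  shows "\<exists>\<Z>. finite \<Z> \<and> card \<Z> \<le> 2 ^ n \<and> \<Union>\<Z> = Z \<and> (\<forall>W\<in>\<Z>. irreducible_upto I A W)"
  using assms(2)
proof (induction n arbitrary: Z)
  case (0 Z)
  show ?case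
  proof (cases "irreducible_upto I A Z")
    case True
    then show ?thesis by (intro exI[of _ "{Z}"]) auto
  next
    case False
    then obtain a b f g z where f: "a + b \<le> A" "f \<in> polys I a" "\<exists>z\<in>Z. f z \<noteq> 0"
      unfolding irreducible_upto_def by blast
    have fA: "f \<in> polys I A" by (rule polys_mono[OF f(2) subset_refl assms(1)]) (use f in simp)
    \<comment> \<open>For \<open>n = 0\<close> there is only one function on \<open>Z\<close>; a
      nonvanishing \<open>f\<close> would give at least \<open>card K \<ge> 2\<close>.\<close>
    have "2 \<le> card (poly_funs I A {x \<in> Z. f x = 0}) * card K"
      using mult_le_mono[OF card_poly_funs_pos[OF assms(1), of A "{x \<in> Z. f x = 0}"] card_K_ge_2] by simp
    also have "\<dots> \<le> card (poly_funs I A Z)" by (rule card_poly_funs_zero_set[OF assms(1) fA f(3)])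
    finally show ?thesis using 0 by simp
  qed
next
  case (Suc n Z)
  show ?case
  proof (cases "irreducible_upto I A Z")
    case True
    then show ?thesis by (intro exI[of _ "{Z}"]) auto
  next
    case False
    then obtain a b f g where fg: "a + b \<le> A" "f \<in> polys I a" "g \<in> polys I b"
      "\<forall>x\<in>Z. f x * g x = 0" "\<exists>z\<in>Z. f z \<noteq> 0" "\<exists>z\<in>Z. g z \<noteq> 0"
      unfolding irreducible_upto_def by blast
    have sub: "\<exists>\<Z>. finite \<Z> \<and> card \<Z> \<le> 2 ^ n \<and> \<Union>\<Z> = {x \<in> Z. h x = 0} \<and> (\<forall>W\<in>\<Z>. irreducible_upto I A W)"
      if h: "h \<in> polys I c" "c \<le> A" "\<exists>z\<in>Z. h z \<noteq> 0" for h c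
    proof (rule Suc.IH)
      have "h \<in> polys I A" by (rule polys_mono[OF h(1) subset_refl assms(1) h(2)])
      have "card (poly_funs I A {x \<in> Z. h x = 0}) * card K \<le> card K ^ n * card K"
        unfolding power_Suc2[symmetric]
        by (rule le_trans[OF card_poly_funs_zero_set Suc.prems]) fact+
      then show "card (poly_funs I A {x \<in> Z. h x = 0}) \<le> card K ^ n"
        using card_K_ge_2 by simp
    qed
    obtain \<F> where F: "finite \<F>" "card \<F> \<le> 2 ^ n" "\<Union>\<F> = {x \<in> Z. f x = 0}" "\<forall>W\<in>\<F>. irreducible_upto I A W"
      using sub[of f a] fg by auto
    obtain \<G> where G: "finite \<G>" "card \<G> \<le> 2 ^ n" "\<Union>\<G> = {x \<in> Z. g x = 0}" "\<forall>W\<in>\<G>. irreducible_upto I A W"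
      using sub[of g b] fg by auto
    have "card (\<F> \<union> \<G>) \<le> 2 ^ Suc n" using card_Un_le[of \<F> \<G>] F(2) G(2) by simp
    moreover have "\<Union>(\<F> \<union> \<G>) = Z" using F(3) G(3) fg(4) by auto
    ultimately show ?thesis using F G by (intro exI[of _ "\<F> \<union> \<G>"]) auto
  qed
qed

text \<open>Restricting a random function to \<open>Z\<close> has at least
  \<open>card K ^ (d + 1)\<close> equally likely results by \<open>card_poly_funs_ge\<close>, and
  only one of them is zero.\<close>

lemma card_vanishing:
  assumes "finite I" "Z \<subseteq> pts I" "d < card Z"
  shows "card {f \<in> poly_funs I d (pts I). \<forall>x\<in>Z. f x = 0} * card K ^ (d + 1) \<le> card (poly_funs I d (pts I))"
proof -
  have "card (poly_funs I d (pts I)) = card (zrestrict Z ` poly_funs I d (pts I)) *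
      card {f \<in> poly_funs I d (pts I). zrestrict Z f = 0}"
    by (rule card_eq_image_kernel) (auto simp: add_subgroup_poly_funs zrestrict_diff finite_poly_funs assms)
  moreover have "zrestrict Z f = 0 \<longleftrightarrow> (\<forall>x\<in>Z. f x = 0)" for f :: "_ \<Rightarrow> 'a"
    by (auto simp: zrestrict_def fun_eq_iff)
  ultimately show ?thesis
    using card_poly_funs_ge[OF assms] poly_funs_restrict[OF assms(2)] by (simp add: mult.commute)
qed

text \<open>Conditioning on the last component \<open>F k\<close>; setting it to 0 turns
  \<open>F\<close> into a \<open>k\<close>-tuple in the sense of \<open>supp_funs\<close>.\<close>

lemma card_supp_funs_Suc_le:
  fixes L :: "'x::zero set" and k :: nat
  assumes "S \<subseteq> supp_funs {..<Suc k} (\<lambda>_. L)" "finite L"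
    and "\<And>F. F \<in> S \<Longrightarrow> F(k := 0) \<in> T (F k)" "\<And>f. f \<in> L \<Longrightarrow> finite (T f)"
  shows "card S \<le> (\<Sum>f\<in>L. card (T f))"
proof -
  have "card S \<le> card (Sigma L T)"
  proof (rule card_inj_on_le[where f="\<lambda>F. (F k, F(k := 0))"])
    show "inj_on (\<lambda>F. (F k, F(k := 0))) S"
    proof (rule inj_onI)
      fix F G assume "(F k, F(k := 0)) = (G k, G(k := 0))"
      then have "F k = G k" "F(k := 0) = G(k := 0)" by auto
      then show "F = G" by (metis fun_upd_triv fun_upd_upd)
    qed
    show "(\<lambda>F. (F k, F(k := 0))) ` S \<subseteq> Sigma L T"
      using assms(1,3) by (auto simp: supp_funs_def)
  qed (use assms in auto)
  also have "\<dots> = (\<Sum>f\<in>L. card (T f))" by (rule card_SigmaI) (use assms in auto)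
  finally show ?thesis .
qed

text \<open>Induction on the number \<open>k\<close> of polynomials. The bound on
  \<open>poly_funs\<close> in degree \<open>a + k * (a * d)\<close> stands in for dimension at most
  \<open>k\<close>: a polynomial that does not vanish on an irreducible part lowers it by one. The
  remaining failures, polynomials vanishing on a whole part, are rare by
  \<open>card_vanishing\<close>.\<close>

lemma card_many_common_zeros:
  fixes I :: "'i set" and a d A k :: nat
  defines "L \<equiv> poly_funs I d (pts I)" and "B \<equiv> 2 ^ ((A + 1) ^ card I)"
  assumes I: "finite I" and a: "a \<ge> 1" and "Z \<subseteq> pts I" and "a + k * (a * d) \<le> A"
    and "card (poly_funs I (a + k * (a * d)) Z) \<le> card K ^ (a ^ (k + 1))"
  shows "card {F \<in> supp_funs {..<k} (\<lambda>_. L). B ^ k * (a + d) < card {x \<in> Z. \<forall>i<k. F i x = 0}} * card K ^ (d + 1)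
    \<le> (2 * B) ^ k * card L ^ k"
  using assms(5-)
proof (induction k arbitrary: Z)
  case (0 Z)
  \<comment> \<open>More than \<open>a\<close> points would carry at least
    \<open>card K ^ (a + 1)\<close> functions of degree \<open>a\<close>, while the hypothesis
    allows \<open>card K ^ a\<close>.\<close>
  have "card Z \<le> a"
  proof (rule ccontr)
    assume "\<not> card Z \<le> a"
    then have "card K ^ (a + 1) \<le> card K ^ a"
      by (intro le_trans[OF card_poly_funs_ge[OF I, of Z a]]) (use 0 in simp_all)
    then have "a + 1 \<le> a" by (rule power_le_imp_le_exp[rotated]) (use card_K_ge_2 in simp)
    then show False by simp
  qed
  then show ?case by simp
next
  case (Suc k Z)
  have finL: "finite L" by (simp add: L_def finite_poly_funs I)
  have finZ: "finite Z" using Suc.prems(1) finite_supp_funs[OF I] finite_K by (meson finite_subset)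
  have B1: "B \<ge> 1" by (simp add: B_def)
  define Bad where "Bad = (\<lambda>k W. {F \<in> supp_funs {..<k} (\<lambda>_. L). B ^ k * (a + d) < card {x \<in> W. \<forall>i<k. F i x = 0}})"
  have finBad: "finite (Bad k W)" for k W
    unfolding Bad_def using finL by (simp add: finite_supp_funs)
  \<comment> \<open>The threshold for one part is that for \<open>k\<close>, although
    \<open>Suc k\<close> polynomials are imposed; the missing factor \<open>B\<close> pays for the
    number of parts.\<close>
  define Bad' where "Bad' = (\<lambda>W. {F \<in> supp_funs {..<Suc k} (\<lambda>_. L).
      B ^ k * (a + d) < card {x \<in> W. \<forall>i<Suc k. F i x = 0}})"
  have finBad': "finite (Bad' W)" for W
    unfolding Bad'_def using finL by (simp add: finite_supp_funs)
  obtain \<Z> where \<Z>: "finite \<Z>" "card \<Z> \<le> B" "\<Union>\<Z> = Z" "\<forall>W\<in>\<Z>. irreducible_upto I A W"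
    using irreducible_decomposition[OF I card_poly_funs_le[OF I]] unfolding B_def by metis
  have sub: "Bad (Suc k) Z \<subseteq> (\<Union>W\<in>\<Z>. Bad' W)"
  proof (rule subsetI, rule ccontr)
    fix F assume F: "F \<in> Bad (Suc k) Z" "F \<notin> (\<Union>W\<in>\<Z>. Bad' W)"
    then have le: "card {x \<in> W. \<forall>i<Suc k. F i x = 0} \<le> B ^ k * (a + d)" if "W \<in> \<Z>" for W
      using that by (auto simp: Bad_def Bad'_def not_less)
    have eq: "{x \<in> Z. \<forall>i<Suc k. F i x = 0} = (\<Union>W\<in>\<Z>. {x \<in> W. \<forall>i<Suc k. F i x = 0})"
      using \<Z>(3) by auto
    have "card {x \<in> Z. \<forall>i<Suc k. F i x = 0} \<le> (\<Sum>W\<in>\<Z>. card {x \<in> W. \<forall>i<Suc k. F i x = 0})"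
      unfolding eq by (rule card_UN_le[OF \<Z>(1)])
    also have "\<dots> \<le> card \<Z> * (B ^ k * (a + d))"
      using sum_bounded_above[of \<Z> "\<lambda>W. card {x \<in> W. \<forall>i<Suc k. F i x = 0}" "B ^ k * (a + d)"] le
      by simp
    also have "\<dots> \<le> B * (B ^ k * (a + d))" by (rule mult_le_mono1[OF \<Z>(2)])
    also have "\<dots> = B ^ Suc k * (a + d)" by simp
    finally show False using F(1) by (simp add: Bad_def)
  qed
  have main: "card (Bad' W) * card K ^ (d + 1) \<le> (1 + (2 * B) ^ k) * card L ^ Suc k" if W: "W \<in> \<Z>" for W
  \<comment> \<open>\<open>card_vanishing\<close> needs more than \<open>d\<close> points; smaller
    parts never exceed the threshold, thanks to its summand \<open>d\<close>.\<close>
  proof (cases "card W \<le> d")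
    case True
    have "finite W" using W \<Z>(3) finZ by (meson Union_upper finite_subset)
    have "card {x \<in> W. \<forall>i<Suc k. F i x = 0} \<le> B ^ k * (a + d)" for F
    proof -
      have "card {x \<in> W. \<forall>i<Suc k. F i x = 0} \<le> card W"
        by (rule card_mono[OF \<open>finite W\<close>]) auto
      also have "\<dots> \<le> 1 * (a + d)" using True by simp
      also have "\<dots> \<le> B ^ k * (a + d)" using B1 by (intro mult_le_mono1) simp
      finally show ?thesis .
    qed
    then have "Bad' W = {}" by (auto simp: Bad'_def not_less)
    then show ?thesis by simp
  next
    case False
    have WZ: "W \<subseteq> Z" using W \<Z>(3) by auto
    define V where "V = {f \<in> L. \<forall>x\<in>W. f x = 0}"
    \<comment> \<open>\<open>T f\<close> collects the possible first \<open>k\<close> components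
      when the last one is \<open>f\<close>: no constraint if \<open>f\<close> vanishes on
      \<open>W\<close>, and otherwise the bad tuples for the zero set of \<open>f\<close>, where the
      induction hypothesis applies.\<close>
    define T where "T = (\<lambda>f. if f \<in> V then supp_funs {..<k} (\<lambda>_. L) else Bad k {x \<in> W. f x = 0})"
    have "card (Bad' W) \<le> (\<Sum>f\<in>L. card (T f))"
    proof (rule card_supp_funs_Suc_le)
      fix F assume F: "F \<in> Bad' W"
      then have *: "F(k := 0) \<in> supp_funs {..<k} (\<lambda>_. L)" by (auto simp: Bad'_def supp_funs_def less_Suc_eq)
      have "{x \<in> W. \<forall>i<Suc k. F i x = 0} = {x \<in> {x \<in> W. F k x = 0}. \<forall>i<k. (F(k := 0)) i x = 0}"
        by (auto simp: less_Suc_eq)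
      then have "B ^ k * (a + d) < card {x \<in> {x \<in> W. F k x = 0}. \<forall>i<k. (F(k := 0)) i x = 0}"
        using F by (simp add: Bad'_def)
      then show "F(k := 0) \<in> T (F k)" unfolding T_def Bad_def using * by auto
    qed (use finL finBad in \<open>auto simp: T_def Bad'_def finite_supp_funs\<close>)
    also have "\<dots> = (\<Sum>f\<in>V. card (T f)) + (\<Sum>f\<in>L - V. card (T f))"
      using sum.subset_diff[of V L "\<lambda>f. card (T f)"] finL by (simp add: V_def)
    also have "(\<Sum>f\<in>V. card (T f)) = card V * card L ^ k"
      by (simp add: T_def card_supp_funs)
    finally have fin: "card (Bad' W) \<le> card V * card L ^ k + (\<Sum>f\<in>L - V. card (T f))" .
    have le: "card (Bad' W) * Q \<le> (card V * Q) * card L ^ k + (\<Sum>f\<in>L - V. card (T f) * Q)" for Q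
    proof -
      have "card (Bad' W) * Q \<le> (card V * card L ^ k + (\<Sum>f\<in>L - V. card (T f))) * Q"
        by (rule mult_le_mono1[OF fin])
      also have "\<dots> = (card V * Q) * card L ^ k + (\<Sum>f\<in>L - V. card (T f) * Q)"
        unfolding distrib_right sum_distrib_right by (simp add: mult_ac)
      finally show ?thesis .
    qed
    have V: "card V * card K ^ (d + 1) \<le> card L"
      unfolding V_def L_def by (rule card_vanishing[OF I]) (use False WZ Suc.prems in auto)
    have T: "card (T f) * card K ^ (d + 1) \<le> (2 * B) ^ k * card L ^ k" if f: "f \<in> L - V" for f
    proof -
      obtain f' where f': "f' \<in> polys I d" "f = zrestrict (pts I) f'"
        using f by (auto simp: L_def poly_funs_def)
      have ff': "f x = f' x" if "x \<in> W" for x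
        using that WZ Suc.prems(1) by (auto simp: f' zrestrict_def)
      then have eq: "{x \<in> W. f x = 0} = {x \<in> W. f' x = 0}" by auto
      have z: "\<exists>z\<in>W. f' z \<noteq> 0" using f ff' by (auto simp: V_def)
      \<comment> \<open>The power bound with \<open>J = a\<close>, followed by an
        \<open>a\<close>-th root, turns the exponent \<open>a ^ (k + 2)\<close> into
        \<open>a ^ (k + 1)\<close>, which is the hypothesis for \<open>k\<close>.\<close>
      have "card (poly_funs I (a + k * (a * d)) {x \<in> W. f' x = 0}) ^ a
          \<le> card (poly_funs I (a + k * (a * d) + a * d) W)"
        by (rule card_poly_funs_power[OF I _ f'(1) z]) (use \<Z>(4) W Suc.prems(2) in auto)
      also have "\<dots> \<le> card (poly_funs I (a + Suc k * (a * d)) Z)"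
        by (rule card_poly_funs_mono[OF I WZ]) simp
      also have "\<dots> \<le> (card K ^ (a ^ (k + 1))) ^ a"
        using Suc.prems(3) by (simp add: power_mult[symmetric] mult_ac)
      finally have "card (poly_funs I (a + k * (a * d)) {x \<in> W. f x = 0}) \<le> card K ^ (a ^ (k + 1))"
        using a by (simp add: eq)
      moreover have "{x \<in> W. f x = 0} \<subseteq> pts I" "a + k * (a * d) \<le> A"
        using WZ Suc.prems by auto
      ultimately show ?thesis using Suc.IH[of "{x \<in> W. f x = 0}"] f by (simp add: T_def Bad_def)
    qed
    have "(\<Sum>f\<in>L - V. card (T f) * card K ^ (d + 1)) \<le> card (L - V) * ((2 * B) ^ k * card L ^ k)"
      using sum_bounded_above[of "L - V" "\<lambda>f. card (T f) * card K ^ (d + 1)" "(2 * B) ^ k * card L ^ k"] T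
      by simp
    also have "\<dots> \<le> card L * ((2 * B) ^ k * card L ^ k)"
      by (intro mult_le_mono1 card_mono finL) auto
    finally have "card (Bad' W) * card K ^ (d + 1)
        \<le> card L * card L ^ k + card L * ((2 * B) ^ k * card L ^ k)"
      using le[of "card K ^ (d + 1)"] mult_le_mono1[OF V, of "card L ^ k"] by linarith
    then show ?thesis by (simp add: algebra_simps)
  qed
  have "card (Bad (Suc k) Z) \<le> card (\<Union>W\<in>\<Z>. Bad' W)"
    by (rule card_mono[OF _ sub]) (use \<Z>(1) finBad' in auto)
  also have "\<dots> \<le> (\<Sum>W\<in>\<Z>. card (Bad' W))" by (rule card_UN_le[OF \<Z>(1)])
  finally have "card (Bad (Suc k) Z) * card K ^ (d + 1) \<le> (\<Sum>W\<in>\<Z>. card (Bad' W) * card K ^ (d + 1))"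
    unfolding sum_distrib_right[symmetric] by (rule mult_le_mono1)
  also have "\<dots> \<le> card \<Z> * ((1 + (2 * B) ^ k) * card L ^ Suc k)"
    using sum_bounded_above[of \<Z> "\<lambda>W. card (Bad' W) * card K ^ (d + 1)"
      "(1 + (2 * B) ^ k) * card L ^ Suc k"] main by simp
  \<comment> \<open>\<open>1 + (2 * B) ^ k \<le> 2 * (2 * B) ^ k\<close> accounts for the 2 in
    \<open>2 * B\<close>.\<close>
  also have "\<dots> \<le> B * ((2 * (2 * B) ^ k) * card L ^ Suc k)"
    by (intro mult_le_mono \<Z>(2) order_refl) (use B1 in simp)
  also have "\<dots> = (2 * B) ^ Suc k * card L ^ Suc k" by simp
  finally show ?case by (simp add: Bad_def)
qed

end

text \<open>
  The number of irreducible parts at level \<open>A = a + t * (a * d)\<close>, where \<open>a = (2 + t * d) ^ t\<close> is chosen so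
  that \<open>(A + 1) ^ t \<le> a ^ (t + 1)\<close>.
\<close>

definition zero_bound_base :: "nat \<Rightarrow> nat \<Rightarrow> nat" where
  "zero_bound_base t d = 2 ^ ((2 + t * d) ^ t * (1 + t * d) + 1) ^ t"

text \<open>The threshold \<open>B ^ k * (a + d)\<close> of \<open>card_many_common_zeros\<close> at
  \<open>k = t\<close>. It is free of \<open>card K\<close>, so \<open>s\<close> can stay fixed
  while the field grows.\<close>

definition zero_bound :: "nat \<Rightarrow> nat \<Rightarrow> nat" where
  "zero_bound t d = zero_bound_base t d ^ t * ((2 + t * d) ^ t + d)"

text \<open>The induction is started at the whole space, whose function count in degree
  \<open>A\<close> is bounded by the number of monomials alone.\<close>

theorem (in finite_subfield) card_many_common_zeros_pts:
  fixes t d :: nat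
  defines "L \<equiv> poly_funs {..<t} d (pts {..<t})"
  shows "card {F \<in> supp_funs {..<t} (\<lambda>_. L). zero_bound t d < card {x \<in> pts {..<t}. \<forall>i<t. F i x = 0}}
      * card K ^ (d + 1) \<le> (2 * zero_bound_base t d) ^ t * card L ^ t"
proof -
  define a where "a = (2 + t * d) ^ t"
  define A where "A = a + t * (a * d)"
  have a1: "a \<ge> 1" by (simp add: a_def)
  have base: "zero_bound_base t d = 2 ^ ((A + 1) ^ card {..<t})"
    by (simp add: zero_bound_base_def A_def a_def algebra_simps)
  have "A + 1 \<le> a * (2 + t * d)" using a1 by (simp add: A_def algebra_simps)
  then have "(A + 1) ^ t \<le> (a * (2 + t * d)) ^ t" by (intro power_mono) auto
  also have "\<dots> = a ^ t * (2 + t * d) ^ t" by (rule power_mult_distrib)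
  also have "\<dots> = a ^ (t + 1)" unfolding a_def[symmetric] by simp
  finally have le: "(A + 1) ^ t \<le> a ^ (t + 1)" .
  have "card (poly_funs {..<t} A (pts {..<t})) \<le> card K ^ ((A + 1) ^ t)"
    using card_poly_funs_le[of "{..<t}"] by simp
  also have "\<dots> \<le> card K ^ (a ^ (t + 1))"
    by (rule power_increasing[OF le]) (use card_K_ge_2 in simp)
  finally have "card (poly_funs {..<t} A (pts {..<t})) \<le> card K ^ (a ^ (t + 1))" .
  then show ?thesis
    using card_many_common_zeros[of "{..<t}" a "pts {..<t}" t d A] a1
    unfolding L_def zero_bound_def base a_def[symmetric] by (simp add: A_def)
qed

section \<open>Random algebraic blow-ups\<close>

text \<open>A point \<open>x\<close> of \<open>pts (V \<times> {..<t})\<close> encodes a transversal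
  of the blow-up: \<open>row x u\<close> is the vertex chosen in the part of
  \<open>u\<close>.\<close>

definition row :: "('v \<times> nat \<Rightarrow> 'b) \<Rightarrow> 'v \<Rightarrow> nat \<Rightarrow> 'b" where
  "row x u = (\<lambda>k. x (u, k))"

definition ins :: "'v \<Rightarrow> (nat \<Rightarrow> 'b) \<Rightarrow> ('v \<times> nat \<Rightarrow> 'b) \<Rightarrow> 'v \<times> nat \<Rightarrow> 'b" where
  "ins a y z = (\<lambda>(u, k). if u = a then y k else z (u, k))"

lemma row_ins [simp]: "row (ins a y z) u = (if u = a then y else row z u)"
  by (auto simp: row_def ins_def)

text \<open>\<open>edges_card\<close> puts into each edge a vertex other than a given centre, and
  \<open>t_le_d\<close> allows interpolation at \<open>t\<close> points; both serve the independence
  of the slices below.\<close>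

locale blowup = finite_subfield K for K :: "'a::field set" +
  fixes V :: "'v set" and E :: "'v set set" and t d :: nat
  assumes finite_V: "finite V" and edges_sub: "e \<in> E \<Longrightarrow> e \<subseteq> V"
    and edges_card: "e \<in> E \<Longrightarrow> card e \<ge> 2" and t_le_d: "t \<le> d + 1"
begin

section \<open>Random families of polynomials\<close>

abbreviation "PT \<equiv> pts (V \<times> {..<t})"
abbreviation "PN \<equiv> pts {..<t}"
abbreviation "L \<equiv> poly_funs {..<t} d PN"

text \<open>The sample space: a uniform member consists of independent uniform functions
  \<open>F e\<close>, each in the coordinates of the vertices of \<open>e\<close>. Probabilities are
  ratios to \<open>card families\<close>.\<close>

definition families :: "('v set \<Rightarrow> ('v \<times> nat \<Rightarrow> 'a) \<Rightarrow> 'a) set" where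
  "families = supp_funs E (\<lambda>e. poly_funs (e \<times> {..<t}) d PT)"

lemma finite_E: "finite E"
  using finite_V edges_sub by (auto intro: finite_subset[of E "Pow V"])

lemma finite_edge: "e \<in> E \<Longrightarrow> finite e"
  using finite_V edges_sub finite_subset by blast

lemma finite_PT: "finite PT" and finite_PN: "finite PN"
  using finite_V finite_K by (simp_all add: finite_supp_funs)

lemma card_PT: "card PT = card K ^ (card V * t)"
  using finite_V by (simp add: card_supp_funs card_cartesian_product)

lemma card_PN: "card PN = card K ^ t"
  by (simp add: card_supp_funs)

lemma finite_families: "finite families"
  unfolding families_def using finite_E finite_edge by (auto intro!: finite_supp_funs finite_poly_funs)

lemma add_subgroup_families: "add_subgroup families"
  unfolding families_def by (intro add_subgroup_supp_funs add_subgroup_poly_funs)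

lemma families_poly:
  assumes "F \<in> families" "e \<in> E"
  obtains f where "f \<in> polys (e \<times> {..<t}) d" "F e = zrestrict PT f"
  using assms by (auto simp: families_def supp_funs_def poly_funs_def)

lemma row_in_PN: "x \<in> PT \<Longrightarrow> u \<in> V \<Longrightarrow> row x u \<in> PN"
  by (auto simp: supp_funs_def row_def)

lemma ins_in_PT: "a \<in> V \<Longrightarrow> y \<in> PN \<Longrightarrow> z \<in> PT \<Longrightarrow> ins a y z \<in> PT"
  by (auto simp: supp_funs_def ins_def)

lemma families_cong:
  assumes "F \<in> families" "e \<in> E" "x \<in> PT" "y \<in> PT" "\<And>u. u \<in> e \<Longrightarrow> row x u = row y u"
  shows "F e x = F e y"
proof -
  obtain f where f: "f \<in> polys (e \<times> {..<t}) d" "F e = zrestrict PT f"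
    using families_poly assms by blast
  have "f x = f y"
    by (rule polys_cong[OF f(1)]) (use assms(5) in \<open>auto simp: row_def fun_eq_iff\<close>)
  then show ?thesis using assms by (simp add: f zrestrict_def)
qed

text \<open>Evaluation of all \<open>F e\<close> at \<open>x\<close> is additive and has at most
  \<open>card K ^ card E\<close> values, which bounds the index of its kernel.\<close>

lemma card_families_zero_at:
  assumes x: "x \<in> PT"
  shows "card families \<le> card K ^ card E * card {F \<in> families. \<forall>e\<in>E. F e x = 0}"
proof -
  define \<phi> where "\<phi> = (\<lambda>F :: 'v set \<Rightarrow> ('v \<times> nat \<Rightarrow> 'a) \<Rightarrow> 'a. \<lambda>e. F e x)"
  have sub: "\<phi> ` families \<subseteq> supp_funs E (\<lambda>_. K)"
  proof (rule image_subsetI)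
    fix F assume F: "F \<in> families"
    have "F e x \<in> K" if e: "e \<in> E" for e
    proof -
      obtain f where f: "f \<in> polys (e \<times> {..<t}) d" "F e = zrestrict PT f"
        using families_poly[OF F e] by blast
      have "f x \<in> K"
        by (rule polys_in_K[OF f(1)]) (use x edges_sub[OF e] in \<open>auto simp: supp_funs_def\<close>)
      then show ?thesis using x by (simp add: f zrestrict_def)
    qed
    moreover have "F e x = 0" if "e \<notin> E" for e using F that by (simp add: families_def supp_funs_def)
    ultimately show "\<phi> F \<in> supp_funs E (\<lambda>_. K)" by (auto simp: \<phi>_def supp_funs_def)
  qed
  have "card (\<phi> ` families) \<le> card (supp_funs E (\<lambda>_. K))"
    by (rule card_mono[OF _ sub]) (simp add: finite_supp_funs finite_E finite_K)
  then have "card (\<phi> ` families) \<le> card K ^ card E" by (simp add: card_supp_funs finite_E)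
  moreover have "card families = card (\<phi> ` families) * card {F \<in> families. \<phi> F = 0}"
    by (rule card_eq_image_kernel) (auto simp: add_subgroup_families finite_families \<phi>_def)
  moreover have "{F \<in> families. \<phi> F = 0} = {F \<in> families. \<forall>e\<in>E. F e x = 0}"
    by (auto simp: \<phi>_def fun_eq_iff families_def supp_funs_def) 
  ultimately show ?thesis by (simp add: mult_le_mono1)
qed

text \<open>
  A vertex \<open>y\<close> in the part of \<open>a\<close> completes each of the \<open>t\<close> partial transversals \<open>\<xi> i\<close> of
  \<open>es i - {a}\<close> to an edge; the row of \<open>\<xi> i\<close> at \<open>a\<close> and outside \<open>es i\<close> is irrelevant.
\<close>

definition star_config :: "'v \<Rightarrow> (nat \<Rightarrow> 'v set) \<Rightarrow> (nat \<Rightarrow> 'v \<times> nat \<Rightarrow> 'a) \<Rightarrow> bool" where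
  "star_config a es \<xi> \<longleftrightarrow> a \<in> V \<and> (\<forall>i<t. es i \<in> E \<and> a \<in> es i \<and> \<xi> i \<in> PT) \<and>
     (\<forall>i<t. \<forall>j<t. i \<noteq> j \<longrightarrow> (\<forall>u \<in> es i \<inter> es j - {a}. row (\<xi> i) u \<noteq> row (\<xi> j) u))"

definition common :: "('v set \<Rightarrow> ('v \<times> nat \<Rightarrow> 'a) \<Rightarrow> 'a) \<Rightarrow> 'v \<Rightarrow> (nat \<Rightarrow> 'v set) \<Rightarrow>
    (nat \<Rightarrow> 'v \<times> nat \<Rightarrow> 'a) \<Rightarrow> (nat \<Rightarrow> 'a) set" where
  "common F a es \<xi> = {y \<in> PN. \<forall>i<t. F (es i) (ins a y (\<xi> i)) = 0}"

definition good :: "('v set \<Rightarrow> ('v \<times> nat \<Rightarrow> 'a) \<Rightarrow> 'a) \<Rightarrow> bool" where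
  "good F \<longleftrightarrow> (\<forall>a es \<xi>. star_config a es \<xi> \<longrightarrow> card (common F a es \<xi>) \<le> zero_bound t d)"

text \<open>The \<open>t\<close> functions of the completing point \<open>y\<close> obtained by
  freezing \<open>F\<close> along the configuration; their common zeros form
  \<open>common F a es \<xi>\<close>.\<close>

definition slices :: "'v \<Rightarrow> (nat \<Rightarrow> 'v set) \<Rightarrow> (nat \<Rightarrow> 'v \<times> nat \<Rightarrow> 'a) \<Rightarrow>
    ('v set \<Rightarrow> ('v \<times> nat \<Rightarrow> 'a) \<Rightarrow> 'a) \<Rightarrow> nat \<Rightarrow> (nat \<Rightarrow> 'a) \<Rightarrow> 'a" where
  "slices a es \<xi> F = (\<lambda>i. if i < t then zrestrict PN (\<lambda>y. F (es i) (ins a y (\<xi> i))) else 0)"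

lemma slices_image_subset:
  assumes "star_config a es \<xi>"
  shows "slices a es \<xi> ` families \<subseteq> supp_funs {..<t} (\<lambda>_. L)"
proof (rule image_subsetI)
  fix F assume F: "F \<in> families"
  have "slices a es \<xi> F i \<in> L" if i: "i < t" for i
  proof -
    have c: "es i \<in> E" "a \<in> es i" "\<xi> i \<in> PT" "a \<in> V" using assms i by (auto simp: star_config_def)
    obtain f where f: "f \<in> polys (es i \<times> {..<t}) d" "F (es i) = zrestrict PT f"
      using families_poly[OF F c(1)] by blast
    have "(\<lambda>y. f (ins a y (\<xi> i))) \<in> polys {..<t} d"
      unfolding ins_def by (rule polys_slice[OF f(1) finite_edge[OF c(1)] _ c(2)])
        (use c edges_sub[OF c(1)] in \<open>auto simp: supp_funs_def\<close>)
    moreover have "slices a es \<xi> F i = zrestrict PN (\<lambda>y. f (ins a y (\<xi> i)))"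
      using i ins_in_PT[OF c(4) _ c(3)] by (simp add: slices_def zrestrict_eq_iff f) (simp add: zrestrict_def)
    ultimately show ?thesis by (simp add: poly_funs_def)
  qed
  then show "slices a es \<xi> F \<in> supp_funs {..<t} (\<lambda>_. L)" by (auto simp: supp_funs_def slices_def)
qed

text \<open>
  Surjectivity makes the \<open>t\<close> slices independent and uniform: at one vertex \<open>w e \<noteq> a\<close> of each edge
  the rows differ, so interpolation there separates the slices belonging to the same \<open>e\<close>.
\<close>

lemma slices_surj:
  assumes conf: "star_config a es \<xi>" and h: "h \<in> supp_funs {..<t} (\<lambda>_. L)"
  shows "h \<in> slices a es \<xi> ` families"
proof -
  have c: "es i \<in> E" "a \<in> es i" "\<xi> i \<in> PT" if "i < t" for i using conf that by (auto simp: star_config_def)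
  have a: "a \<in> V" using conf by (simp add: star_config_def)
  have "\<exists>g\<in>polys {..<t} d. h i = zrestrict PN g" if "i < t" for i
    using h that by (auto simp: supp_funs_def poly_funs_def)
  then obtain g where g: "\<And>i. i < t \<Longrightarrow> g i \<in> polys {..<t} d" "\<And>i. i < t \<Longrightarrow> h i = zrestrict PN (g i)"
    by metis
  have "\<exists>u. u \<in> e \<and> u \<noteq> a" if "e \<in> E" for e
  proof (rule ccontr)
    assume "\<nexists>u. u \<in> e \<and> u \<noteq> a"
    then have "e \<subseteq> {a}" by auto
    then have "card e \<le> 1" using card_mono[of "{a}" e] by simp
    then show False using edges_card[OF that] by simp
  qed
  then obtain w where w: "\<And>e. e \<in> E \<Longrightarrow> w e \<in> e" "\<And>e. e \<in> E \<Longrightarrow> w e \<noteq> a" by metis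
  have "\<exists>p\<in>polys {..<t} d. p (row (\<xi> i) (w (es i))) = 1 \<and>
      (\<forall>j<t. j \<noteq> i \<longrightarrow> es j = es i \<longrightarrow> p (row (\<xi> j) (w (es i))) = 0)" if i: "i < t" for i
  proof -
    define u where "u = w (es i)"
    have u: "u \<in> es i" "u \<noteq> a" "u \<in> V" using w c[OF i] edges_sub by (auto simp: u_def)
    define S where "S = (\<lambda>j. row (\<xi> j) u) ` {..<t}"
    define k where "k = (\<lambda>y. if y = row (\<xi> i) u then 1 else 0 :: 'a)"
    have "\<exists>p\<in>polys {..<t} d. \<forall>y\<in>S. p y = k y"
    proof (rule polys_interpolate)
      show "S \<subseteq> PN" unfolding S_def using c u by (auto intro: row_in_PN)
      show "card S \<le> d + 1" unfolding S_def using card_image_le[of "{..<t}"] t_le_d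
        by (metis card_lessThan finite_lessThan le_trans)
    qed (auto simp: S_def k_def)
    then obtain p where p: "p \<in> polys {..<t} d" "\<And>y. y \<in> S \<Longrightarrow> p y = k y" by blast
    have "p (row (\<xi> i) u) = 1" using p(2)[of "row (\<xi> i) u"] i by (simp add: S_def k_def)
    moreover have "p (row (\<xi> j) u) = 0" if j: "j < t" "j \<noteq> i" "es j = es i" for j
    proof -
      have "row (\<xi> j) u \<noteq> row (\<xi> i) u" using conf j i u unfolding star_config_def by auto
      then show ?thesis using p(2)[of "row (\<xi> j) u"] j by (simp add: S_def k_def)
    qed
    ultimately show ?thesis using p(1) unfolding u_def by blast
  qed
  then obtain p where p: "\<And>i. i < t \<Longrightarrow> p i \<in> polys {..<t} d"
    "\<And>i. i < t \<Longrightarrow> p i (row (\<xi> i) (w (es i))) = 1"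
    "\<And>i j. i < t \<Longrightarrow> j < t \<Longrightarrow> j \<noteq> i \<Longrightarrow> es j = es i \<Longrightarrow> p i (row (\<xi> j) (w (es i))) = 0"
    by metis
  \<comment> \<open>At the configuration point \<open>\<xi> j\<close> only the summand
    \<open>i = j\<close> survives, by the choice of \<open>p\<close>. The factors use the disjoint
    rows \<open>a\<close> and \<open>w e\<close>, so the degree stays at most
    \<open>d\<close>.\<close>
  define f where "f = (\<lambda>e x. \<Sum>i\<in>{i. i < t \<and> es i = e}. g i (row x a) * p i (row x (w e)))"
  define F where "F = (\<lambda>e. if e \<in> E then zrestrict PT (f e) else 0)"
  have "f e \<in> polys (e \<times> {..<t}) d" if e: "e \<in> E" for e
    unfolding f_def
  proof (rule polys_sum)
    fix i assume i: "i \<in> {i. i < t \<and> es i = e}"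
    have 1: "(\<lambda>x. g i (row x a)) \<in> polys ({a} \<times> {..<t}) d"
      unfolding row_def by (rule polys_row) (use g i in auto)
    have 2: "(\<lambda>x. p i (row x (w e))) \<in> polys ({w e} \<times> {..<t}) d"
      unfolding row_def by (rule polys_row) (use p i in auto)
    have "(\<lambda>x. g i (row x a)) * (\<lambda>x. p i (row x (w e))) \<in> polys ({a} \<times> {..<t} \<union> {w e} \<times> {..<t}) d"
      by (rule polys_mult_disjoint[OF 1 2]) (use w[OF e] in auto)
    then have "(\<lambda>x. g i (row x a)) * (\<lambda>x. p i (row x (w e))) \<in> polys (e \<times> {..<t}) d"
      by (rule polys_mono) (use w[OF e] c i e finite_edge in auto)
    then show "(\<lambda>x. g i (row x a) * p i (row x (w e))) \<in> polys (e \<times> {..<t}) d"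
      by (simp add: times_fun_def)
  qed
  then have "F \<in> families" by (auto simp: families_def supp_funs_def F_def poly_funs_def)
  moreover have "slices a es \<xi> F = h"
  proof
    fix j
    show "slices a es \<xi> F j = h j"
    proof (cases "j < t")
      case False
      then show ?thesis using h by (simp add: slices_def supp_funs_def)
    next
      case True
      have "F (es j) (ins a y (\<xi> j)) = g j y" if y: "y \<in> PN" for y
      proof -
        have "F (es j) (ins a y (\<xi> j)) = f (es j) (ins a y (\<xi> j))"
          using c[OF True] ins_in_PT[OF a y] by (simp add: F_def zrestrict_def)
        also have "\<dots> = (\<Sum>i\<in>{i. i < t \<and> es i = es j}. g i y * p i (row (\<xi> j) (w (es j))))"
          unfolding f_def using w[OF c(1)[OF True]] by simp
        also have "\<dots> = (\<Sum>i\<in>{i. i < t \<and> es i = es j}. if i = j then g j y else 0)"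
        proof (rule sum.cong)
          fix i assume "i \<in> {i. i < t \<and> es i = es j}"
          then show "g i y * p i (row (\<xi> j) (w (es j))) = (if i = j then g j y else 0)"
            using p(2)[of j] p(3)[of i j] True by auto
        qed simp
        also have "\<dots> = g j y" using True by simp
        finally show ?thesis .
      qed
      then show ?thesis using g True by (simp add: slices_def zrestrict_eq_iff)
    qed
  qed
  ultimately show ?thesis by blast
qed

text \<open>The slices map \<open>families\<close> onto all \<open>t\<close>-tuples from
  \<open>L\<close> with equal fibres, so the bound on tuples with many common zeros carries
  over.\<close>

lemma card_star_config_bad:
  assumes conf: "star_config a es \<xi>"
  shows "card {F \<in> families. zero_bound t d < card (common F a es \<xi>)} * card K ^ (d + 1)
    \<le> (2 * zero_bound_base t d) ^ t * card families"
proof -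
  let ?\<phi> = "slices a es \<xi>"
  define Bad where "Bad = {h \<in> supp_funs {..<t} (\<lambda>_. L). zero_bound t d < card {y \<in> PN. \<forall>i<t. h i y = 0}}"
  have hom: "?\<phi> (F - G) = ?\<phi> F - ?\<phi> G" for F G
    by (auto simp: slices_def zrestrict_def fun_eq_iff)
  have im: "?\<phi> ` families = supp_funs {..<t} (\<lambda>_. L)"
    using slices_image_subset[OF conf] slices_surj[OF conf] by auto
  let ?ker = "card {F \<in> families. ?\<phi> F = 0}"
  have "card families = card (?\<phi> ` families) * ?ker"
    by (rule card_eq_image_kernel[OF add_subgroup_families hom finite_families])
  then have families: "card families = card L ^ t * ?ker" by (simp add: im card_supp_funs)
  have eq: "common F a es \<xi> = {y \<in> PN. \<forall>i<t. ?\<phi> F i y = 0}" for F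
    by (auto simp: common_def slices_def zrestrict_def)
  have "{F \<in> families. zero_bound t d < card (common F a es \<xi>)} = {F \<in> families. ?\<phi> F \<in> Bad}"
    using im by (auto simp: Bad_def eq)
  also have "card \<dots> = card Bad * ?ker"
    by (rule card_preimage[OF add_subgroup_families hom finite_families]) (auto simp: im Bad_def)
  finally have "card {F \<in> families. zero_bound t d < card (common F a es \<xi>)} * card K ^ (d + 1)
      = (card Bad * card K ^ (d + 1)) * ?ker" by (simp only: mult_ac)
  also have "\<dots> \<le> ((2 * zero_bound_base t d) ^ t * card L ^ t) * ?ker"
    unfolding Bad_def by (rule mult_le_mono1[OF card_many_common_zeros_pts])
  also have "\<dots> = (2 * zero_bound_base t d) ^ t * card families" unfolding families by (simp only: mult_ac)
  finally show ?thesis .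
qed

text \<open>Union bound over star configurations. There are at most
  \<open>card PT ^ t = card K ^ (card V * t * t)\<close> choices of \<open>\<xi>\<close>, an
  exponent that does not depend on \<open>d\<close>.\<close>

lemma card_not_good:
  "card {F \<in> families. \<not> good F} * card K ^ (d + 1)
    \<le> (card V * card E ^ t * card K ^ (card V * t * t)) * ((2 * zero_bound_base t d) ^ t * card families)"
proof -
  define C where "C = {(a, es, \<xi>). (a, es, \<xi>) \<in> V \<times> ({..<t} \<rightarrow>\<^sub>E E) \<times> ({..<t} \<rightarrow>\<^sub>E PT) \<and> star_config a es \<xi>}"
  have C_sub: "C \<subseteq> V \<times> ({..<t} \<rightarrow>\<^sub>E E) \<times> ({..<t} \<rightarrow>\<^sub>E PT)" by (auto simp: C_def)
  have fin: "finite (V \<times> ({..<t} \<rightarrow>\<^sub>E E) \<times> ({..<t} \<rightarrow>\<^sub>E PT))"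
    using finite_V finite_E finite_PT by (intro finite_cartesian_product finite_PiE) auto
  have card_C: "card C \<le> card V * card E ^ t * card K ^ (card V * t * t)"
    using card_mono[OF fin C_sub]
    by (simp add: card_cartesian_product card_PiE card_PT power_mult mult.assoc)
  define B where "B = (\<lambda>(a, es, \<xi>). {F \<in> families. zero_bound t d < card (common F a es \<xi>)})"
  have "{F \<in> families. \<not> good F} \<subseteq> (\<Union>c\<in>C. B c)"
  proof
    fix F assume "F \<in> {F \<in> families. \<not> good F}"
    then obtain a es \<xi> where F: "F \<in> families" "star_config a es \<xi>" "zero_bound t d < card (common F a es \<xi>)"
      by (auto simp: good_def not_le)
    \<comment> \<open>Neither \<open>star_config\<close> nor \<open>common\<close> looks at indices
      outside \<open>{..<t}\<close>; cutting them off leaves finitely many configurations.\<close>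
    let ?es = "restrict es {..<t}" and ?\<xi> = "restrict \<xi> {..<t}"
    have "star_config a ?es ?\<xi>" using F(2) by (simp add: star_config_def)
    moreover have "common F a ?es ?\<xi> = common F a es \<xi>" by (simp add: common_def)
    moreover have "?es \<in> {..<t} \<rightarrow>\<^sub>E E" "?\<xi> \<in> {..<t} \<rightarrow>\<^sub>E PT" "a \<in> V"
      using F(2) by (auto simp: star_config_def)
    ultimately have "(a, ?es, ?\<xi>) \<in> C" "F \<in> B (a, ?es, ?\<xi>)"
      using F by (auto simp: C_def B_def)
    then show "F \<in> (\<Union>c\<in>C. B c)" by blast
  qed
  moreover have finC: "finite C" using fin C_sub by (rule finite_subset[rotated])
  ultimately have "card {F \<in> families. \<not> good F} \<le> card (\<Union>c\<in>C. B c)"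
    by (intro card_mono) (auto simp: B_def finite_families)
  also have "\<dots> \<le> (\<Sum>c\<in>C. card (B c))" by (rule card_UN_le[OF finC])
  finally have "card {F \<in> families. \<not> good F} * card K ^ (d + 1) \<le> (\<Sum>c\<in>C. card (B c) * card K ^ (d + 1))"
    unfolding sum_distrib_right[symmetric] by (rule mult_le_mono1)
  also have "\<dots> \<le> (\<Sum>c\<in>C. (2 * zero_bound_base t d) ^ t * card families)"
  proof (rule sum_mono)
    fix c assume "c \<in> C"
    then show "card (B c) * card K ^ (d + 1) \<le> (2 * zero_bound_base t d) ^ t * card families"
      using card_star_config_bad unfolding C_def B_def by auto
  qed
  also have "\<dots> = card C * ((2 * zero_bound_base t d) ^ t * card families)" by simp
  also have "\<dots> \<le> (card V * card E ^ t * card K ^ (card V * t * t)) * ((2 * zero_bound_base t d) ^ t * card families)"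
    by (rule mult_le_mono1[OF card_C])
  finally show ?thesis .
qed

section \<open>Existence of a good family with many zeros\<close>

definition zeros :: "('v set \<Rightarrow> ('v \<times> nat \<Rightarrow> 'a) \<Rightarrow> 'a) \<Rightarrow> ('v \<times> nat \<Rightarrow> 'a) set" where
  "zeros F = {x \<in> PT. \<forall>e\<in>E. F e x = 0}"

text \<open>Double counting of pairs of a family and a common zero: on average at least one in
  \<open>card K ^ card E\<close> transversals survives.\<close>

lemma sum_card_zeros: "card PT * card families \<le> card K ^ card E * (\<Sum>F\<in>families. card (zeros F))"
proof -
  have "card PT * card families = (\<Sum>x\<in>PT. card families)" by simp
  also have "\<dots> \<le> (\<Sum>x\<in>PT. card K ^ card E * card {F \<in> families. \<forall>e\<in>E. F e x = 0})"
    by (rule sum_mono) (rule card_families_zero_at)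
  also have "\<dots> = card K ^ card E * (\<Sum>x\<in>PT. card {F \<in> families. \<forall>e\<in>E. F e x = 0})"
    by (simp add: sum_distrib_left)
  also have "(\<Sum>x\<in>PT. card {F \<in> families. \<forall>e\<in>E. F e x = 0}) = (\<Sum>F\<in>families. card (zeros F))"
    unfolding zeros_def using finite_PT finite_families by (intro sum_multicount_gen) auto
  finally show ?thesis .
qed

text \<open>Otherwise good families contribute less than half of the lower bound in
  \<open>sum_card_zeros\<close>. Bad ones, even with all of \<open>PT\<close> as zeros, contribute
  at most half, since their proportion is at most \<open>1 / (2 * card K ^ card E)\<close>.\<close>

theorem ex_good:
  assumes q: "2 * (card V * card E ^ t * (2 * zero_bound_base t d) ^ t) \<le> card K"
    and d: "card V * t * t + card E \<le> d"
  shows "\<exists>F\<in>families. good F \<and> card PT \<le> 2 * card K ^ card E * card (zeros F)"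
proof (rule ccontr)
  assume contr: "\<not> ?thesis"
  define q where "q = card K"
  define m where "m = card E"
  define c where "c = card V * card E ^ t * (2 * zero_bound_base t d) ^ t"
  let ?bad = "{F \<in> families. \<not> good F}" and ?good = "{F \<in> families. good F}"
  have q0: "q > 0" using card_K_ge_2 by (simp add: q_def)
  have Om0: "card families > 0" using add_subgroup_families finite_families by (auto simp: card_gt_0_iff add_subgroup_def)
  have "card ?bad * q ^ (d + 1) \<le> q ^ (card V * t * t) * (c * card families)"
    using card_not_good by (simp add: c_def q_def mult_ac)
  \<comment> \<open>The bound on \<open>d\<close> leaves, beyond the number of configurations and
    \<open>q ^ m\<close>, one spare factor \<open>q\<close>, which will absorb the constant
    \<open>2 * c\<close>.\<close>
  moreover have "q ^ (card V * t * t) * (card ?bad * q ^ m * q) \<le> card ?bad * q ^ (d + 1)"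
  proof -
    have "q ^ (card V * t * t) * (card ?bad * q ^ m * q) = card ?bad * q ^ (card V * t * t + m + 1)"
      by (simp add: power_add mult_ac)
    also have "\<dots> \<le> card ?bad * q ^ (d + 1)"
      using d q0 by (intro mult_le_mono2 power_increasing) (auto simp: m_def)
    finally show ?thesis .
  qed
  ultimately have "q ^ (card V * t * t) * (card ?bad * q ^ m * q) \<le> q ^ (card V * t * t) * (c * card families)"
    by linarith
  then have *: "card ?bad * q ^ m * q \<le> c * card families" using q0 by simp
  have bad: "2 * (card ?bad * q ^ m) \<le> card families"
  proof (cases "c = 0")
    case True
    then have "card ?bad * q ^ m * q \<le> 0" using * by simp
    then have "card ?bad * q ^ m = 0" using q0 by simp
    then show ?thesis by linarith
  next
    case False
    have "c * (2 * (card ?bad * q ^ m)) = card ?bad * q ^ m * (2 * c)" by simp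
    also have "\<dots> \<le> card ?bad * q ^ m * q" using q by (intro mult_le_mono2) (simp add: q_def c_def)
    also have "\<dots> \<le> c * card families" by (rule *)
    finally show ?thesis using False by simp
  qed
  have "card ?bad \<le> card ?bad * q ^ m" using q0 by simp
  then have "card ?bad < card families" using bad Om0 by linarith
  moreover have split: "card ?good + card ?bad = card families"
  proof -
    have "card (?good \<union> ?bad) = card ?good + card ?bad"
      by (rule card_Un_disjoint) (auto simp: finite_families)
    moreover have "?good \<union> ?bad = families" by auto
    ultimately show ?thesis by simp
  qed
  ultimately have "card ?good > 0" by linarith
  then have ne: "?good \<noteq> {}" by (metis card.empty less_irrefl)
  have "(\<Sum>F\<in>families. 2 * q ^ m * card (zeros F))
      = (\<Sum>F\<in>?good. 2 * q ^ m * card (zeros F)) + (\<Sum>F\<in>?bad. 2 * q ^ m * card (zeros F))"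
  proof -
    have "families = ?good \<union> ?bad" by auto
    moreover have "(\<Sum>F\<in>?good \<union> ?bad. 2 * q ^ m * card (zeros F))
      = (\<Sum>F\<in>?good. 2 * q ^ m * card (zeros F)) + (\<Sum>F\<in>?bad. 2 * q ^ m * card (zeros F))"
      by (rule sum.union_disjoint) (auto simp: finite_families)
    ultimately show ?thesis by simp
  qed
  moreover have "(\<Sum>F\<in>?good. 2 * q ^ m * card (zeros F)) < (\<Sum>F\<in>?good. card PT)"
    by (rule sum_strict_mono) (use contr ne in \<open>auto simp: finite_families q_def m_def not_le\<close>)
  moreover have "(\<Sum>F\<in>?bad. 2 * q ^ m * card (zeros F)) \<le> (\<Sum>F\<in>?bad. 2 * q ^ m * card PT)"
    by (intro sum_mono mult_le_mono2 card_mono finite_PT) (auto simp: zeros_def)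
  moreover have "(\<Sum>F\<in>?bad. 2 * q ^ m * card PT) \<le> card families * card PT"
    using mult_le_mono1[OF bad, of "card PT"] by (simp add: mult_ac)
  moreover have "(\<Sum>F\<in>?good. card PT) \<le> card families * card PT"
    using split by (simp add: mult_le_mono1)
  moreover have "2 * (card families * card PT) \<le> (\<Sum>F\<in>families. 2 * q ^ m * card (zeros F))"
    using mult_le_mono2[OF sum_card_zeros, of 2]
    by (simp add: q_def m_def sum_distrib_left[symmetric] mult.assoc mult.commute[of "card families"])
  ultimately show False by linarith
qed

end

section \<open>Copies in the blow-up and freeness\<close>

context blowup
begin

definition emb :: "('v \<times> (nat \<Rightarrow> 'a) \<Rightarrow> nat) \<Rightarrow> ('v \<times> nat \<Rightarrow> 'a) \<Rightarrow> 'v \<Rightarrow> nat" where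
  "emb \<iota> x u = \<iota> (u, row x u)"

text \<open>Numbers below \<open>n\<close> outside the image of \<open>\<iota>\<close> become
  isolated vertices, so that there are exactly \<open>n\<close> vertices.\<close>

definition blowup_graph ::
  "('v \<times> (nat \<Rightarrow> 'a) \<Rightarrow> nat) \<Rightarrow> nat \<Rightarrow> ('v set \<Rightarrow> ('v \<times> nat \<Rightarrow> 'a) \<Rightarrow> 'a) \<Rightarrow> nat hypergraph" where
  "blowup_graph \<iota> n F = ({..<n}, {emb \<iota> x ` e | e x. e \<in> E \<and> x \<in> PT \<and> F e x = 0})"

context
  fixes \<iota> :: "'v \<times> (nat \<Rightarrow> 'a) \<Rightarrow> nat" and n :: nat
  assumes inj: "inj_on \<iota> (V \<times> PN)" and range: "\<iota> ` (V \<times> PN) \<subseteq> {..<n}"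
begin

lemma emb_eqD:
  assumes "emb \<iota> x u = emb \<iota> y w" "x \<in> PT" "y \<in> PT" "u \<in> V" "w \<in> V"
  shows "u = w" "row x u = row y w"
  using inj_onD[OF inj assms(1)[unfolded emb_def]] assms row_in_PN by auto

lemma inj_emb: "x \<in> PT \<Longrightarrow> inj_on (emb \<iota> x) V"
  using emb_eqD by (auto intro: inj_onI)

lemma r_graph_blowup:
  assumes "\<And>e. e \<in> E \<Longrightarrow> card e = r"
  shows "r_graph r (blowup_graph \<iota> n F)"
proof -
  have "emb \<iota> x ` e \<subseteq> {..<n} \<and> card (emb \<iota> x ` e) = r" if "e \<in> E" "x \<in> PT" for e x
  proof
    show "emb \<iota> x ` e \<subseteq> {..<n}"
      using range row_in_PN[OF that(2)] edges_sub[OF that(1)] by (force simp: emb_def)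
    have "inj_on (emb \<iota> x) e" using inj_emb[OF that(2)] edges_sub[OF that(1)] by (rule inj_on_subset)
    then show "card (emb \<iota> x ` e) = r" using assms[OF that(1)] by (simp add: card_image)
  qed
  then show ?thesis unfolding r_graph_def blowup_graph_def fst_conv snd_conv by blast
qed

text \<open>Copies are unlabelled, but the parts have disjoint images under \<open>\<iota>\<close>,
  so the vertex set of a copy already determines its transversal.\<close>

lemma card_zeros_le_copies:
  assumes "finite (copies (V, E) (blowup_graph \<iota> n F))"
  shows "card (zeros F) \<le> card (copies (V, E) (blowup_graph \<iota> n F))"
proof (rule card_inj_on_le[OF _ _ assms])
  let ?S = "\<lambda>x. (emb \<iota> x ` V, (\<lambda>e. emb \<iota> x ` e) ` E)"
  show "inj_on ?S (zeros F)"
  proof (rule inj_onI)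
    fix x y assume xy: "x \<in> zeros F" "y \<in> zeros F" and "?S x = ?S y"
    then have eq: "emb \<iota> x ` V = emb \<iota> y ` V" and PT: "x \<in> PT" "y \<in> PT" by (auto simp: zeros_def)
    have "row x u = row y u" if u: "u \<in> V" for u
    proof -
      obtain w where "w \<in> V" "emb \<iota> x u = emb \<iota> y w" using eq u by blast
      then show ?thesis using emb_eqD[of x u y w] PT u by auto
    qed
    then have "x (u, k) = y (u, k)" if "u \<in> V" for u k
      using that unfolding row_def by meson
    moreover have "x (u, k) = y (u, k)" if "u \<notin> V" for u k
      using that PT by (auto simp: supp_funs_def)
    ultimately show "x = y" by fast
  qed
  show "?S ` zeros F \<subseteq> copies (V, E) (blowup_graph \<iota> n F)"
  proof (rule image_subsetI)
    fix x assume x: "x \<in> zeros F"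
    then have PT: "x \<in> PT" by (simp add: zeros_def)
    have "subhypergraph (?S x) (blowup_graph \<iota> n F)"
      unfolding subhypergraph_def
    proof (intro conjI ballI)
      show "verts (?S x) \<subseteq> verts (blowup_graph \<iota> n F)"
        using range row_in_PN[OF PT] by (force simp: emb_def blowup_graph_def)
      show "edges (?S x) \<subseteq> edges (blowup_graph \<iota> n F)"
        using x by (auto simp: zeros_def blowup_graph_def)
    qed (use edges_sub in auto)
    moreover have "hypergraph_iso (V, E) (?S x)"
      unfolding hypergraph_iso_def using inj_emb[OF PT]
      by (intro exI[of _ "emb \<iota> x"]) (auto simp: bij_betw_def)
    ultimately show "?S x \<in> copies (V, E) (blowup_graph \<iota> n F)" by (simp add: copies_def)
  qed
qed

text \<open>By pigeonhole more than \<open>zero_bound t d\<close> vertices of the \<open>Y\<close>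
  side lie in one part \<open>a\<close>. The sets \<open>bip_X r i\<close> then give a star
  configuration with all those vertices in its \<open>common\<close> set, contradicting
  \<open>good F\<close>.\<close>

lemma blowup_graph_free:
  assumes F: "F \<in> families" "good F" and t: "t \<ge> 1" and s: "card V * zero_bound t d < s"
  shows "hypergraph_free (complete_bip r s t) (blowup_graph \<iota> n F)"
  unfolding hypergraph_free_def
proof (rule equals0I)
  fix S assume "S \<in> copies (complete_bip r s t) (blowup_graph \<iota> n F)"
  then obtain f where f: "bij_betw f (verts (complete_bip r s t)) (verts S)"
    and fE: "(\<lambda>A. f ` A) ` edges (complete_bip r s t) = edges S"
    and S: "edges S \<subseteq> edges (blowup_graph \<iota> n F)"
    by (auto simp: copies_def subhypergraph_def hypergraph_iso_def)
  have f_inj: "inj_on f ((\<Union>i<t. bip_X r i) \<union> bip_Y s)"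
    using f by (simp add: bij_betw_def complete_bip_def)
  have edge: "\<exists>e x. e \<in> E \<and> x \<in> PT \<and> F e x = 0 \<and> emb \<iota> x ` e = insert (f (Inr k)) (f ` bip_X r i)"
    if "i < t" "k < s" for i k
  proof -
    have "bip_X r i \<union> {Inr k} \<in> edges (complete_bip r s t)"
      using that by (force simp: complete_bip_def bip_Y_def)
    then have "f ` (bip_X r i \<union> {Inr k}) \<in> edges (blowup_graph \<iota> n F)" using fE S by blast
    then obtain e x where "e \<in> E" "x \<in> PT" "F e x = 0" "f ` (bip_X r i \<union> {Inr k}) = emb \<iota> x ` e"
      by (auto simp: blowup_graph_def)
    then show ?thesis by (intro exI[of _ e] exI[of _ x]) auto
  qed
  then have "\<forall>i k. \<exists>c. i < t \<longrightarrow> k < s \<longrightarrow> fst c \<in> E \<and> snd c \<in> PT \<and> F (fst c) (snd c) = 0 \<and>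
      emb \<iota> (snd c) ` fst c = insert (f (Inr k)) (f ` bip_X r i)"
    by (metis fst_conv snd_conv)
  then obtain c where c: "\<And>i k. i < t \<Longrightarrow> k < s \<Longrightarrow> fst (c i k) \<in> E \<and> snd (c i k) \<in> PT \<and>
      F (fst (c i k)) (snd (c i k)) = 0 \<and>
      emb \<iota> (snd (c i k)) ` fst (c i k) = insert (f (Inr k)) (f ` bip_X r i)"
    by metis
  define e where "e = (\<lambda>i k. fst (c i k))"
  define x where "x = (\<lambda>i k. snd (c i k))"
  have ex: "e i k \<in> E" "x i k \<in> PT" "F (e i k) (x i k) = 0"
      "emb \<iota> (x i k) ` e i k = insert (f (Inr k)) (f ` bip_X r i)" if "i < t" "k < s" for i k
    using c[OF that] by (simp_all add: e_def x_def)
  \<comment> \<open>As \<open>t \<ge> 1\<close>, the index 0 is available to locate the part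
    \<open>b k\<close> that contains \<open>f (Inr k)\<close>.\<close>
  have "\<exists>u. u \<in> V \<and> u \<in> e 0 k \<and> f (Inr k) = emb \<iota> (x 0 k) u" if k: "k < s" for k
    using ex(1,4)[of 0 k] k t edges_sub by fastforce
  then obtain b where b: "\<And>k. k < s \<Longrightarrow> b k \<in> V" "\<And>k. k < s \<Longrightarrow> f (Inr k) = emb \<iota> (x 0 k) (b k)"
    by metis
  define p where "p = (\<lambda>k. row (x 0 k) (b k))"
  have p: "p k \<in> PN" "f (Inr k) = \<iota> (b k, p k)" if "k < s" for k
    using row_in_PN ex(2)[of 0 k] b that t by (auto simp: p_def emb_def)
  have f_ne: "f (Inr k) \<notin> f ` bip_X r i" if "i < t" "k < s" for i k
  proof
    assume "f (Inr k) \<in> f ` bip_X r i"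
    then obtain z where "z \<in> bip_X r i" "f z = f (Inr k)" by auto
    moreover from this have "z = Inr k"
      by (intro inj_onD[OF f_inj]) (use that in \<open>auto simp: bip_Y_def\<close>)
    ultimately show False by (auto simp: bip_X_def)
  qed
  have f_inj_Y: "k = l" if "f (Inr k) = f (Inr l)" "k < s" "l < s" for k l
    using inj_onD[OF f_inj that(1)] that by (auto simp: bip_Y_def)
  have f_disj: "f ` bip_X r i \<inter> f ` bip_X r j = {}" if "i < t" "j < t" "i \<noteq> j" for i j
  proof -
    have "bip_X r i \<inter> bip_X r j = {}" using that by (auto simp: bip_X_def)
    then show ?thesis
      using inj_on_image_Int[OF f_inj, of "bip_X r i" "bip_X r j"] that by auto
  qed
  obtain a where a: "zero_bound t d < card {k \<in> {..<s}. b k = a}"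
  proof (rule ccontr)
    assume *: "\<not> thesis"
    have "s = card (\<Union>a\<in>V. {k \<in> {..<s}. b k = a})"
    proof -
      have "(\<Union>a\<in>V. {k \<in> {..<s}. b k = a}) = {..<s}" using b by auto
      then show ?thesis by simp
    qed
    also have "\<dots> \<le> (\<Sum>a\<in>V. card {k \<in> {..<s}. b k = a})" by (rule card_UN_le[OF finite_V])
    also have "\<dots> \<le> (\<Sum>a\<in>V. zero_bound t d)"
      by (rule sum_mono) (use * that in \<open>meson not_le\<close>)
    finally show False using s by simp
  qed
  define M where "M = {k \<in> {..<s}. b k = a}"
  have "card M > 0" using a unfolding M_def by linarith
  then have "M \<noteq> {}" by auto
  then obtain k0 where k0: "k0 \<in> M" by auto
  have M: "k < s" "b k = a" if "k \<in> M" for k using that by (auto simp: M_def)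
  have aV: "a \<in> V" using b M k0 by blast
  have mem: "a \<in> e i k \<and> row (x i k) a = p k" if "i < t" "k \<in> M" for i k
  proof -
    have "f (Inr k) \<in> emb \<iota> (x i k) ` e i k" using ex(4)[of i k] that M by simp
    then obtain u where u: "u \<in> e i k" "f (Inr k) = emb \<iota> (x i k) u" by blast
    then have u': "emb \<iota> (x 0 k) a = emb \<iota> (x i k) u" using b(2)[of k] M[OF that(2)] by simp
    have "u \<in> V" using u edges_sub ex(1) that M by blast
    then show ?thesis
      using emb_eqD[OF u'] u(1) ex(2) that M aV t unfolding p_def by auto
  qed
  have off: "emb \<iota> (x i k) u \<in> f ` bip_X r i" if "i < t" "k \<in> M" "u \<in> e i k" "u \<noteq> a" for i k u
  proof -
    have "emb \<iota> (x i k) u \<in> insert (f (Inr k)) (f ` bip_X r i)"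
      using ex(4)[of i k] that M by blast
    moreover have "emb \<iota> (x i k) u \<noteq> f (Inr k)"
    proof
      assume "emb \<iota> (x i k) u = f (Inr k)"
      then have *: "emb \<iota> (x i k) u = emb \<iota> (x 0 k) a" using b(2)[of k] M that by simp
      have "u \<in> V" using that edges_sub ex(1) M by blast
      then have "u = a" using emb_eqD(1)[OF *] ex(2) M t that aV by simp
      then show False using that by simp
    qed
    ultimately show ?thesis by blast
  qed
  \<comment> \<open>For \<open>u \<noteq> a\<close> the image lies in that of
    \<open>bip_X r i\<close>, which does not depend on \<open>k\<close>; so off \<open>a\<close> the
    transversals for all \<open>k \<in> M\<close> coincide on the edge.\<close>
  have agree: "u \<in> e i l \<and> row (x i k) u = row (x i l) u"
    if "i < t" "k \<in> M" "l \<in> M" "u \<in> e i k" "u \<noteq> a" for i k l u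
  proof -
    have "emb \<iota> (x i k) u \<in> emb \<iota> (x i l) ` e i l"
      using off[OF that(1,2,4,5)] ex(4)[of i l] that M by blast
    then obtain w where w: "w \<in> e i l" "emb \<iota> (x i k) u = emb \<iota> (x i l) w" by blast
    have "u \<in> V" "w \<in> V" using w that edges_sub ex(1) M by blast+
    then show ?thesis using emb_eqD[OF w(2)] w(1) ex(2) that M by simp
  qed
  have same: "e i k = e i k0" if "i < t" "k \<in> M" for i k
    using agree[OF that(1,2) k0] agree[OF that(1) k0 that(2)] mem that k0 by blast
  define es where "es = (\<lambda>i. e i k0)"
  define \<xi> where "\<xi> = (\<lambda>i. x i k0)"
  have "star_config a es \<xi>"
    unfolding star_config_def
  proof (intro conjI allI impI ballI aV)
    fix i assume i: "i < t"
    show "es i \<in> E" "\<xi> i \<in> PT" "a \<in> es i"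
      using ex i M[OF k0] mem[OF i k0] by (auto simp: es_def \<xi>_def)
    fix j u assume j: "j < t" "i \<noteq> j" and u: "u \<in> es i \<inter> es j - {a}"
    have "emb \<iota> (\<xi> i) u \<in> f ` bip_X r i" "emb \<iota> (\<xi> j) u \<in> f ` bip_X r j"
      using off k0 i j u by (auto simp: es_def \<xi>_def)
    \<comment> \<open>Disjointness of the sets \<open>bip_X r i\<close> is what separates the
      partial transversals.\<close>
    then show "row (\<xi> i) u \<noteq> row (\<xi> j) u" using f_disj[OF i j] unfolding emb_def by (metis disjoint_iff)
  qed
  moreover have "p ` M \<subseteq> common F a es \<xi>"
  proof (rule image_subsetI)
    fix k assume k: "k \<in> M"
    have pk: "p k \<in> PN" using p M k by blast
    have "F (es i) (ins a (p k) (\<xi> i)) = 0" if i: "i < t" for i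
    proof -
      have PT: "x i k \<in> PT" "x i k0 \<in> PT" "e i k0 \<in> E" using ex i M k k0 by blast+
      \<comment> \<open>Both arguments have the same rows on the edge: \<open>p k\<close> at
        \<open>a\<close>, and equal rows elsewhere by \<open>agree\<close>.\<close>
      have "F (e i k0) (ins a (p k) (x i k0)) = F (e i k0) (x i k)"
      proof (rule families_cong[OF F(1) PT(3) ins_in_PT[OF aV pk PT(2)] PT(1)])
        fix u assume "u \<in> e i k0"
        then show "row (ins a (p k) (x i k0)) u = row (x i k) u"
          using mem[OF i k] agree[OF i k0 k] by auto
      qed
      also have "\<dots> = 0" using ex(3)[OF i] M k same[OF i k] by metis
      finally show ?thesis by (simp add: es_def \<xi>_def)
    qed
    then show "p k \<in> common F a es \<xi>" using pk by (simp add: common_def)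
  qed
  moreover have "inj_on p M"
  proof (rule inj_onI)
    fix k l assume "k \<in> M" "l \<in> M" "p k = p l"
    then show "k = l" using f_inj_Y[of k l] p(2) M by simp
  qed
  ultimately have "card M \<le> card (common F a es \<xi>)" "card (common F a es \<xi>) \<le> zero_bound t d"
    using F(2) card_inj_on_le[of p M "common F a es \<xi>"] finite_PN by (auto simp: good_def common_def)
  then show False using a by (simp add: M_def)
qed

end
end

section \<open>Lower bounds for \<open>ex\<close>\<close>

lemma finite_r_graphs: "finite {G :: nat hypergraph. r_graph r G \<and> verts G = {..<n}}"
proof (rule finite_subset)
  show "{G :: nat hypergraph. r_graph r G \<and> verts G = {..<n}} \<subseteq> {{..<n}} \<times> Pow (Pow {..<n})"
    by (fastforce simp: r_graph_def)
qed simp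

lemma finite_copies:
  assumes "finite (verts G)"
  shows "finite (copies T G)"
proof (rule finite_subset)
  show "copies T G \<subseteq> Pow (verts G) \<times> Pow (Pow (verts G))"
    by (force simp: copies_def subhypergraph_def)
qed (use assms in simp)

lemma ex_ge:
  assumes "r_graph r G" "verts G = {..<n}" "hypergraph_free H G"
  shows "card (copies T G) \<le> ex r n T H"
  unfolding ex_def
proof (rule Max_ge)
  have "{card (copies T G) | G :: nat hypergraph. r_graph r G \<and> verts G = {..<n} \<and> hypergraph_free H G}
      \<subseteq> (\<lambda>G. card (copies T G)) ` {G :: nat hypergraph. r_graph r G \<and> verts G = {..<n}}" by auto
  then show "finite {card (copies T G) | G :: nat hypergraph. r_graph r G \<and> verts G = {..<n} \<and> hypergraph_free H G}"
    using finite_r_graphs by (meson finite_imageI finite_subset)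
qed (use assms in blast)

theorem (in blowup) ex_blowup_ge:
  assumes q: "2 * (card V * card E ^ t * (2 * zero_bound_base t d) ^ t) \<le> card K"
    and d: "card V * t * t + card E \<le> d"
    and r: "\<And>e. e \<in> E \<Longrightarrow> card e = r" and t: "t \<ge> 1"
    and s: "card V * zero_bound t d < s" and n: "card V * card K ^ t \<le> n"
  shows "card K ^ (card V * t) \<le> 2 * card K ^ card E * ex r n (V, E) (complete_bip r s t)"
proof -
  obtain F where F: "F \<in> families" "good F" "card PT \<le> 2 * card K ^ card E * card (zeros F)"
    using ex_good[OF q d] by blast
  have fin: "finite (V \<times> PN)" using finite_V finite_PN by simp
  obtain h where h: "bij_betw h (V \<times> PN) {..<card (V \<times> PN)}"
    using ex_bij_betw_finite_nat[OF fin] by (auto simp: lessThan_atLeast0)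
  have \<iota>: "inj_on h (V \<times> PN)" "h ` (V \<times> PN) \<subseteq> {..<n}"
    using h n by (auto simp: bij_betw_def card_cartesian_product card_PN)
  let ?G = "blowup_graph h n F"
  have vG: "verts ?G = {..<n}" by (simp add: blowup_graph_def)
  have "card (zeros F) \<le> card (copies (V, E) ?G)"
    by (rule card_zeros_le_copies[OF \<iota> finite_copies]) (simp add: vG)
  also have "\<dots> \<le> ex r n (V, E) (complete_bip r s t)"
    by (rule ex_ge[OF r_graph_blowup[OF \<iota> r] vG blowup_graph_free[OF \<iota> F(1,2) t s]])
  finally have "card (zeros F) \<le> ex r n (V, E) (complete_bip r s t)" .
  with F(3) show ?thesis unfolding card_PT by (meson le_trans mult_le_mono2)
qed

text \<open>Only powers of 2 serve as field orders. The greatest admissible \<open>k\<close> loses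
  at most a factor \<open>2 ^ t\<close> against \<open>n\<close>, which affects only the
  constant.\<close>

lemma dyadic_scale:
  fixes w t k0 n :: nat
  assumes t: "t \<ge> 1" and w: "w \<ge> 1" and n: "w * (2 ^ k0) ^ t \<le> n"
  obtains k where "k \<ge> k0" "w * (2 ^ k) ^ t \<le> n" "n < w * (2 ^ t * (2 ^ k) ^ t)"
proof -
  let ?P = "\<lambda>k. w * (2 ^ k) ^ t \<le> n"
  have bound: "k \<le> n" if "?P k" for k
  proof -
    have "k < 2 ^ k" by simp
    also have "(2::nat) ^ k \<le> (2 ^ k) ^ t" using t by (intro self_le_power) auto
    also have "\<dots> \<le> w * (2 ^ k) ^ t" using w by simp
    finally show ?thesis using that by linarith
  qed
  define k where "k = (GREATEST k. ?P k)"
  have "?P k" unfolding k_def by (rule GreatestI_nat[of ?P, OF n bound])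
  moreover have "k \<ge> k0" unfolding k_def by (rule Greatest_le_nat[of ?P, OF n bound])
  moreover have "\<not> ?P (Suc k)"
    using Greatest_le_nat[of ?P "Suc k" n] bound unfolding k_def by fastforce
  then have "n < w * (2 ^ t * (2 ^ k) ^ t)" by (simp add: power_mult_distrib not_le)
  ultimately show thesis using that by blast
qed

theorem theorem1p2:
  fixes r t v e :: nat and T :: "'a hypergraph"
  assumes "r \<ge> 3" and "t \<ge> 1"
    and "r_graph r T" and "card (verts T) = v" and "card (edges T) = e"
  shows "\<exists>c::nat. \<forall>s\<ge>c.
    (\<lambda>n. real (ex r n T (complete_bip r s t)))
      \<in> \<Omega>(\<lambda>n. real n powr (real v - real e / real t))"
proof -
  \<comment> \<open>\<open>v * t * t + e\<close> is required by \<open>ex_good\<close>, and the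
    summand \<open>t\<close> ensures \<open>t_le_d\<close>.\<close>
  define d where "d = v * t * t + e + t"
  define q0 where "q0 = 2 * (v * e ^ t * (2 * zero_bound_base t d) ^ t)"
  define w where "w = real v - real e / real t"
  \<comment> \<open>\<open>v + 1\<close> in place of \<open>v\<close> keeps the scale positive for
    an empty vertex set; \<open>2 ^ (q0 + 1)\<close> forces the field order above
    \<open>q0\<close>.\<close>
  define N0 where "N0 = (v + 1) * (2 ^ (q0 + 1)) ^ t"
  \<comment> \<open>The 2 comes from \<open>ex_good\<close>. In the minimum, 1 serves
    \<open>w < 0\<close>, and the other term the comparison of \<open>n\<close> with
    \<open>q ^ t\<close> for \<open>w \<ge> 0\<close>.\<close>
  define \<delta> where "\<delta> = min 1 (1 / (real (v + 1) * 2 ^ t) powr w) / 2"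
  have \<delta>: "\<delta> > 0" by (simp add: \<delta>_def)
  have main: "\<delta> * real n powr w \<le> real (ex r n T (complete_bip r s t))"
    if s: "s \<ge> v * zero_bound t d + 1" and n: "n \<ge> N0" for s n
  proof -
    obtain k where k: "k \<ge> q0 + 1" "(v + 1) * (2 ^ k) ^ t \<le> n" "n < (v + 1) * (2 ^ t * (2 ^ k) ^ t)"
      using dyadic_scale[OF assms(2) _ n[unfolded N0_def]] by auto
    obtain K :: "bit alg_closure set" where K: "finite_subfield K" "card K = 2 ^ k"
      using finite_subfield_of_card[of k] k by auto
    interpret blowup K "verts T" "edges T" t d
      using K(1) assms unfolding blowup_def blowup_axioms_def
      by (auto simp: r_graph_def d_def)
    define q where "q = (2::nat) ^ k"
    have "q0 \<le> q" using k(1) less_exp[of k] unfolding q_def by linarith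
    have "card K ^ (card (verts T) * t) \<le> 2 * card K ^ card (edges T) * ex r n (verts T, edges T) (complete_bip r s t)"
    proof (rule ex_blowup_ge)
      show "2 * (card (verts T) * card (edges T) ^ t * (2 * zero_bound_base t d) ^ t) \<le> card K"
        using \<open>q0 \<le> q\<close> by (simp add: assms K q_def q0_def)
      show "card (verts T) * card K ^ t \<le> n" using k(2) by (simp add: assms K)
    qed (use assms s in \<open>auto simp: d_def r_graph_def\<close>)
    then have "q ^ (v * t) \<le> 2 * q ^ e * ex r n T (complete_bip r s t)"
      by (simp add: assms K q_def)
    then have "real (q ^ (v * t)) \<le> real (2 * q ^ e * ex r n T (complete_bip r s t))" by (simp only: of_nat_le_iff)
    then have le: "real q ^ (v * t) / real q ^ e / 2 \<le> real (ex r n T (complete_bip r s t))"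
      by (simp add: field_simps q_def)
    define Q where "Q = real q ^ t"
    have q1: "q \<ge> 1" by (simp add: q_def)
    have Q1: "Q \<ge> 1" using q1 by (simp add: Q_def)
    have Qw: "Q powr w = real q ^ (v * t) / real q ^ e"
    proof -
      have "Q powr w = real q powr (real t * w)"
        using q1 by (simp add: Q_def powr_powr powr_realpow[symmetric])
      also have "real t * w = real (v * t) - real e" using assms(2) by (simp add: w_def field_simps)
      also have "real q powr (real (v * t) - real e) = real q ^ (v * t) / real q ^ e"
        using q1 by (simp add: powr_diff powr_realpow del: of_nat_mult)
      finally show ?thesis .
    qed
    have Qn: "Q \<le> real n"
    proof -
      have "q ^ t \<le> n" using k(2) by (simp add: q_def)
      then show ?thesis unfolding Q_def by (metis of_nat_le_iff of_nat_power)
    qed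
    have nQ: "real n \<le> real (v + 1) * 2 ^ t * Q"
    proof -
      have "real n \<le> real ((v + 1) * (2 ^ t * q ^ t))" using k(3) unfolding q_def by (simp only: of_nat_le_iff)
      then show ?thesis by (simp add: Q_def algebra_simps)
    qed
    have "min 1 (1 / (real (v + 1) * 2 ^ t) powr w) * real n powr w \<le> Q powr w"
    \<comment> \<open>For \<open>w \<ge> 0\<close> the upper bound \<open>nQ\<close> on
      \<open>n\<close> is needed, for \<open>w < 0\<close> the lower bound
      \<open>Qn\<close>.\<close>
    proof (cases "w \<ge> 0")
      case True
      have "min 1 (1 / (real (v + 1) * 2 ^ t) powr w) * real n powr w
          \<le> 1 / (real (v + 1) * 2 ^ t) powr w * (real (v + 1) * 2 ^ t * Q) powr w"
        by (intro mult_mono powr_mono2 True nQ) auto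
      also have "\<dots> = Q powr w" using Q1 by (simp add: powr_mult)
      finally show ?thesis .
    next
      case False
      have "min 1 (1 / (real (v + 1) * 2 ^ t) powr w) * real n powr w \<le> 1 * real n powr w"
        by (intro mult_right_mono) auto
      also have "\<dots> \<le> Q powr w" using powr_mono2'[of w Q "real n"] Q1 Qn False by simp
      finally show ?thesis .
    qed
    then show ?thesis using le by (simp add: \<delta>_def Qw)
  qed
  show ?thesis
  \<comment> \<open>The threshold for \<open>s\<close> comes from the pigeonhole over
    \<open>v\<close> parts; it depends on \<open>v\<close>, \<open>e\<close> and \<open>t\<close>,
    not on \<open>n\<close>.\<close>
  proof (intro exI[of _ "v * zero_bound t d + 1"] allI impI)
    fix s assume s: "s \<ge> v * zero_bound t d + 1"
    show "(\<lambda>n. real (ex r n T (complete_bip r s t))) \<in> \<Omega>(\<lambda>n. real n powr (real v - real e / real t))"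
      unfolding w_def[symmetric]
    proof (rule landau_omega.bigI[OF \<delta>])
      show "\<forall>\<^sub>F n in sequentially. norm (real (ex r n T (complete_bip r s t))) \<ge> \<delta> * norm (real n powr w)"
        using eventually_ge_at_top[of N0] by eventually_elim (use main[OF s] in simp)
    qed
  qed
qed

end
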